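(* Let $n\ge 1$ and let $\varphi:\mathbb{B}_n\to\mathbb{B}_n$ be a holomorphic self-map of the unit ball of $\mathbb{C}^n$ with a fixed point $a\in\mathbb{B}_n$ such that $\mathrm{sp}\, d_a\varphi\subset\mathbb{D}$. Then the following statements are equivalent. (i) $C_\varphi$ is mean ergodic on $H^\infty(\mathbb{B}_n)$. (ii) $C_\varphi$ is uniformly mean ergodic on $H^\infty(\mathbb{B}_n)$. (iii) $\|\varphi_j-a\|_\infty\to 0$ as $j\to\infty$. (iv) $C_\varphi$ is quasi-compact on $H^\infty(\mathbb{B}_n)$.
   Context: $\mathbb{B}_n=\{z\in\mathbb{C}^n: |z|<1\}$ is the open Euclidean unit ball, $\mathbb{D}=\mathbb{B}_1$. $H^\infty(\mathbb{B}_n)$ is the Banach space of bounded holomorphic functions $f:\mathbb{B}_n\to\mathbb{C}$ with the supremum norm. For a holomorphic self-map $\varphi$ of $\mathbb{B}_n$, $C_\varphi f=f\circ\varphi$, and $\varphi_j$ denotes the $j$-th iterate $\varphi\circ\cdots\circ\varphi$ ($j$ times). $\|\varphi_j-a\|_\infty=\sup_{z\in\mathbb{B}_n}|\varphi_j(z)-a|$. For a bounded operator $T$ on a Banach space $X$, let $M_j(T)=\frac1j\sum_{i=1}^j T^i$; $T$ is mean ergodic if $M_j(T)$ converges in the strong operator topology to a bounded operator on $X$, and uniformly mean ergodic if $M_j(T)$ converges in operator norm. The essential norm is $\|T\|_e=\inf\{\|T-K\|: K \text{ a compact operator on } X\}$, and $T$ is quasi-compact if $\|T^{n_0}\|_e<1$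 for some $n_0\in\mathbb{N}$. $d_a\varphi=\varphi'(a)$ is the complex derivative of $\varphi$ at $a$ (an $n\times n$ matrix) and $\mathrm{sp}$ denotes the spectrum (set of eigenvalues). *)

theory Defs
  imports "HOL-Analysis.Analysis"
begin

section \<open>Complex normed spaces\<close>

class complex_normed_vector = real_normed_vector +
  fixes scaleC :: "complex \<Rightarrow> 'a \<Rightarrow> 'a"  (infixr \<open>*\<^sub>C\<close> 75)
  assumes scaleC_add_right: "c *\<^sub>C (x + y) = c *\<^sub>C x + c *\<^sub>C y"
    and scaleC_add_left: "(c + d) *\<^sub>C x = c *\<^sub>C x + d *\<^sub>C x"
    and scaleC_scaleC: "c *\<^sub>C d *\<^sub>C x = (c * d) *\<^sub>C x"
    and scaleC_of_real: "complex_of_real r *\<^sub>C x = r *\<^sub>R x"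
    and norm_scaleC: "norm (c *\<^sub>C x) = cmod c * norm x"

instantiation complex :: complex_normed_vector
begin

definition scaleC_complex :: "complex \<Rightarrow> complex \<Rightarrow> complex"
  where "scaleC_complex c x = c * x"

instance
  by standard (auto simp: scaleC_complex_def algebra_simps norm_mult scaleR_conv_of_real)

end

instantiation vec :: (complex_normed_vector, finite) complex_normed_vector
begin

definition scaleC_vec :: "complex \<Rightarrow> 'a ^ 'b \<Rightarrow> 'a ^ 'b"
  where "scaleC_vec c x = (\<chi> i. c *\<^sub>C (x $ i))"

instance
  by standard
    (auto simp: scaleC_vec_def vec_eq_iff scaleC_add_right scaleC_add_left scaleC_scaleC
      scaleC_of_real norm_scaleC norm_vec_def L2_set_right_distrib)

end

lemma scaleC_vec_complex: "c *\<^sub>C x = c *s x" for x :: "complex ^ 'n"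
  by (simp add: vec_eq_iff scaleC_vec_def scaleC_complex_def)

definition bounded_clinear :: "('a::complex_normed_vector \<Rightarrow> 'b::complex_normed_vector) \<Rightarrow> bool"
  where "bounded_clinear T \<longleftrightarrow> bounded_linear T \<and> (\<forall>c x. T (c *\<^sub>C x) = c *\<^sub>C T x)"

section \<open>Ergodicity and quasi-compactness of bounded operators\<close>

definition cesaro_mean :: "nat \<Rightarrow> ('a::complex_normed_vector \<Rightarrow> 'a) \<Rightarrow> 'a \<Rightarrow> 'a"
  where "cesaro_mean j T x = (1 / real j) *\<^sub>R (\<Sum>i=1..j. (T ^^ i) x)"

definition mean_ergodic :: "('a::complex_normed_vector \<Rightarrow> 'a) \<Rightarrow> bool"
  where "mean_ergodic T \<longleftrightarrow>
    (\<exists>P. bounded_clinear P \<and> (\<forall>x. (\<lambda>j. cesaro_mean j T x) \<longlonglongrightarrow> P x))"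

definition uniformly_mean_ergodic :: "('a::complex_normed_vector \<Rightarrow> 'a) \<Rightarrow> bool"
  where "uniformly_mean_ergodic T \<longleftrightarrow>
    (\<exists>P. bounded_clinear P \<and> (\<lambda>j. onorm (\<lambda>x. cesaro_mean j T x - P x)) \<longlonglongrightarrow> 0)"

definition compact_operator :: "('a::complex_normed_vector \<Rightarrow> 'b::complex_normed_vector) \<Rightarrow> bool"
  where "compact_operator K \<longleftrightarrow> bounded_clinear K \<and> compact (closure (K ` cball 0 1))"

definition essential_norm :: "('a::complex_normed_vector \<Rightarrow> 'a) \<Rightarrow> real"
  where "essential_norm T = Inf {onorm (\<lambda>x. T x - K x) | K :: 'a \<Rightarrow> 'a. compact_operator K}"

text \<open>The exponent in quasi-compactness is positive; \<^term>\<open>T ^^ 0\<close> is the identity.\<close>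

definition quasi_compact :: "('a::complex_normed_vector \<Rightarrow> 'a) \<Rightarrow> bool"
  where "quasi_compact T \<longleftrightarrow> (\<exists>m\<ge>1. essential_norm (T ^^ m) < 1)"

section \<open>Holomorphic functions of several variables\<close>

definition holomorphic_map_on ::
    "('a::complex_normed_vector \<Rightarrow> 'b::complex_normed_vector) \<Rightarrow> 'a set \<Rightarrow> bool"
  where "holomorphic_map_on f S \<longleftrightarrow>
    open S \<and> (\<forall>z\<in>S. \<exists>D. bounded_clinear D \<and> (f has_derivative D) (at z))"

text \<open>The complex derivative of \<open>\<phi>\<close> at \<open>z\<close> is the library's \<^term>\<open>jacobian \<phi> (at z)\<close>,
  which is generic in the scalar type; at complex scalars it has complex entries.\<close>

lemma holomorphic_map_on_jacobian:
  fixes \<phi> :: "complex ^ 'n \<Rightarrow> complex ^ 'm"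
  assumes "holomorphic_map_on \<phi> S" "z \<in> S"
  shows "(\<phi> has_derivative (*v) (jacobian \<phi> (at z))) (at z)"
proof -
  obtain D where D: "bounded_clinear D" "(\<phi> has_derivative D) (at z)"
    using assms unfolding holomorphic_map_on_def by blast
  have "Vector_Spaces.linear (*s) (*s) D"
    using D(1) unfolding bounded_clinear_def scaleC_vec_complex
    by (simp add: Vector_Spaces.linear_iff linear_add[OF bounded_linear.linear]
        vec.vector_space_axioms)
  then have "(*v) (matrix D) = D"
    by (simp add: fun_eq_iff matrix_works)
  then show ?thesis
    using D(2) by (simp add: jacobian_def frechet_derivative_at[OF D(2), symmetric])
qed

definition matrix_spectrum :: "complex ^ 'n ^ 'n \<Rightarrow> complex set"
  where "matrix_spectrum A = {c. \<exists>v. v \<noteq> 0 \<and> A *v v = c *s v}"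

text \<open>The Euclidean unit ball of \<open>\<complex>\<^sup>n\<close> is \<^term>\<open>ball 0 1 :: (complex ^ 'n) set\<close>. Since
  functions are total, an element of \<open>H\<^sup>\<infinity>\<close> is represented by its extension by \<open>0\<close>
  outside the ball.\<close>

definition Hinf_set :: "(complex ^ 'n \<Rightarrow> complex) set"
  where "Hinf_set = {f. holomorphic_map_on f (ball 0 1) \<and> bounded (f ` ball 0 1) \<and>
    (\<forall>z. z \<notin> ball 0 1 \<longrightarrow> f z = 0)}"

lemma bounded_clinear_zero: "bounded_clinear (\<lambda>_. 0)"
proof -
  have "c *\<^sub>C (0::'b::complex_normed_vector) = 0" for c
    using norm_scaleC[of c "0::'b"] by simp
  then show ?thesis by (simp add: bounded_clinear_def)
qed

lemma bounded_clinear_add: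
  "bounded_clinear S \<Longrightarrow> bounded_clinear T \<Longrightarrow> bounded_clinear (\<lambda>x. S x + T x)"
  by (simp add: bounded_clinear_def bounded_linear_add scaleC_add_right)

lemma bounded_clinear_scaleC:
  assumes "bounded_clinear T"
  shows "bounded_clinear (\<lambda>x. c *\<^sub>C T x)"
proof -
  have "bounded_linear (\<lambda>x::'b. c *\<^sub>C x)"
  proof (rule bounded_linear_intro[where K = "cmod c"])
    show "c *\<^sub>C r *\<^sub>R x = r *\<^sub>R c *\<^sub>C x" for r and x :: 'b
      by (simp flip: scaleC_of_real add: scaleC_scaleC mult.commute)
  qed (simp_all add: scaleC_add_right norm_scaleC mult.commute)
  then show ?thesis
    using assms bounded_linear_compose
    by (fastforce simp: bounded_clinear_def scaleC_scaleC mult.commute)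
qed

lemma bounded_clinear_compose:
  "bounded_clinear S \<Longrightarrow> bounded_clinear T \<Longrightarrow> bounded_clinear (\<lambda>x. S (T x))"
  by (auto simp: bounded_clinear_def intro: bounded_linear_compose)

lemma Hinf_setI:
  assumes "\<And>z. z \<in> ball 0 1 \<Longrightarrow> \<exists>D. bounded_clinear D \<and> (f has_derivative D) (at z)"
    and "\<And>z. z \<in> ball 0 1 \<Longrightarrow> cmod (f z) \<le> b"
    and "\<And>z. z \<notin> ball 0 1 \<Longrightarrow> f z = 0"
  shows "f \<in> Hinf_set"
  unfolding Hinf_set_def holomorphic_map_on_def bounded_iff
  using assms by blast

lemma Hinf_set_derivE:
  assumes "f \<in> Hinf_set" "z \<in> ball 0 1"
  obtains D where "bounded_clinear D" "(f has_derivative D) (at z)"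
  using assms unfolding Hinf_set_def holomorphic_map_on_def by blast

lemma Hinf_set_boundE:
  assumes "f \<in> Hinf_set"
  obtains b where "\<And>z. z \<in> ball 0 1 \<Longrightarrow> cmod (f z) \<le> b"
  using assms unfolding Hinf_set_def bounded_iff by blast

lemma Hinf_set_outside: "f \<in> Hinf_set \<Longrightarrow> z \<notin> ball 0 1 \<Longrightarrow> f z = 0"
  unfolding Hinf_set_def by blast

lemma Hinf_set_zero: "(\<lambda>_. 0) \<in> Hinf_set"
proof (rule Hinf_setI[where b = 0])
  show "\<exists>D. bounded_clinear D \<and> ((\<lambda>_. 0) has_derivative D) (at z)" for z :: "complex ^ 'a"
    by (intro exI[of _ "\<lambda>_. 0"] conjI bounded_clinear_zero has_derivative_const)
qed simp_all

lemma Hinf_set_add: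
  fixes f g :: "complex ^ 'n \<Rightarrow> complex"
  assumes f: "f \<in> Hinf_set" and g: "g \<in> Hinf_set"
  shows "(\<lambda>z. f z + g z) \<in> Hinf_set"
proof -
  obtain b where b: "\<And>z. z \<in> ball 0 1 \<Longrightarrow> cmod (f z) \<le> b"
    using Hinf_set_boundE[OF f] by blast
  obtain c where c: "\<And>z. z \<in> ball 0 1 \<Longrightarrow> cmod (g z) \<le> c"
    using Hinf_set_boundE[OF g] by blast
  show ?thesis
  proof (rule Hinf_setI[where b = "b + c"])
    fix z :: "complex ^ 'n" assume z: "z \<in> ball 0 1"
    obtain D where D: "bounded_clinear D" "(f has_derivative D) (at z)"
      using Hinf_set_derivE[OF f z] .
    obtain E where E: "bounded_clinear E" "(g has_derivative E) (at z)"
      using Hinf_set_derivE[OF g z] .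
    show "\<exists>D. bounded_clinear D \<and> ((\<lambda>z. f z + g z) has_derivative D) (at z)"
      using bounded_clinear_add[OF D(1) E(1)] has_derivative_add[OF D(2) E(2)] by blast
    show "cmod (f z + g z) \<le> b + c"
      using b[OF z] c[OF z] by (rule norm_add_rule_thm)
  qed (simp add: Hinf_set_outside[OF f] Hinf_set_outside[OF g])
qed

lemma Hinf_set_scaleC:
  fixes f :: "complex ^ 'n \<Rightarrow> complex"
  assumes f: "f \<in> Hinf_set"
  shows "(\<lambda>z. c * f z) \<in> Hinf_set"
proof -
  obtain b where b: "\<And>z. z \<in> ball 0 1 \<Longrightarrow> cmod (f z) \<le> b"
    using Hinf_set_boundE[OF f] by blast
  show ?thesis
  proof (rule Hinf_setI[where b = "cmod c * b"])
    fix z :: "complex ^ 'n" assume z: "z \<in> ball 0 1"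
    obtain D where D: "bounded_clinear D" "(f has_derivative D) (at z)"
      using Hinf_set_derivE[OF f z] .
    have "bounded_clinear (\<lambda>x. c * D x)"
      using bounded_clinear_scaleC[OF D(1), of c] by (simp add: scaleC_complex_def)
    with has_derivative_mult_right[OF D(2), of c]
    show "\<exists>D. bounded_clinear D \<and> ((\<lambda>z. c * f z) has_derivative D) (at z)" by blast
    show "cmod (c * f z) \<le> cmod c * b"
      using b[OF z] by (simp add: norm_mult mult_left_mono)
  qed (simp add: Hinf_set_outside[OF f])
qed

section \<open>The space of bounded holomorphic functions on the ball\<close>

typedef (overloaded) 'n Hinf = "Hinf_set :: (complex ^ 'n::finite \<Rightarrow> complex) set"
  morphisms Hinf_fun Abs_Hinf
  using Hinf_set_zero by blast

setup_lifting type_definition_Hinf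

lemma Hinf_eqI: "(\<And>z. Hinf_fun f z = Hinf_fun g z) \<Longrightarrow> f = g"
  by (simp add: Hinf_fun_inject[symmetric] fun_eq_iff)

instantiation Hinf :: (finite) real_vector
begin

lift_definition zero_Hinf :: "'a Hinf" is "\<lambda>_. 0"
  by (rule Hinf_set_zero)

lift_definition plus_Hinf :: "'a Hinf \<Rightarrow> 'a Hinf \<Rightarrow> 'a Hinf" is "\<lambda>f g z. f z + g z"
  by (rule Hinf_set_add)

lift_definition uminus_Hinf :: "'a Hinf \<Rightarrow> 'a Hinf" is "\<lambda>f z. - f z"
  using Hinf_set_scaleC[of _ "-1"] by simp

lift_definition minus_Hinf :: "'a Hinf \<Rightarrow> 'a Hinf \<Rightarrow> 'a Hinf" is "\<lambda>f g z. f z - g z"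
  using Hinf_set_add[OF _ Hinf_set_scaleC[of _ "-1"]] by simp

lift_definition scaleR_Hinf :: "real \<Rightarrow> 'a Hinf \<Rightarrow> 'a Hinf" is "\<lambda>r f z. r *\<^sub>R f z"
  using Hinf_set_scaleC by (simp add: scaleR_conv_of_real)

instance
  by standard (transfer; simp add: algebra_simps)+

end

lemma Hinf_bdd_above: "bdd_above ((\<lambda>z. cmod (Hinf_fun f z)) ` ball 0 1)"
  using Hinf_set_boundE[OF Hinf_fun[of f]] by (metis bdd_aboveI2)

instantiation Hinf :: (finite) real_normed_vector
begin

definition norm_Hinf :: "'a Hinf \<Rightarrow> real"
  where "norm_Hinf f = (SUP z\<in>ball 0 1. cmod (Hinf_fun f z))"

definition dist_Hinf :: "'a Hinf \<Rightarrow> 'a Hinf \<Rightarrow> real"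
  where "dist_Hinf f g = norm (f - g)"

definition sgn_Hinf :: "'a Hinf \<Rightarrow> 'a Hinf"
  where "sgn_Hinf f = f /\<^sub>R norm f"

definition uniformity_Hinf :: "('a Hinf \<times> 'a Hinf) filter"
  where "uniformity_Hinf = (INF e\<in>{0<..}. principal {(f, g). dist f g < e})"

definition open_Hinf :: "'a Hinf set \<Rightarrow> bool"
  where "open_Hinf U \<longleftrightarrow> (\<forall>f\<in>U. eventually (\<lambda>(f', g). f' = f \<longrightarrow> g \<in> U) uniformity)"

lemma Hinf_norm_le: "cmod (Hinf_fun f z) \<le> norm f"
proof (cases "z \<in> ball 0 1")
  case True
  then show ?thesis unfolding norm_Hinf_def by (rule cSUP_upper[OF _ Hinf_bdd_above])
next
  case False
  then have "Hinf_fun f z = 0" using Hinf_fun[of f] by (simp add: Hinf_set_def)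
  moreover have "0 \<le> cmod (Hinf_fun f 0)" by simp
  moreover have "cmod (Hinf_fun f 0) \<le> norm f"
    unfolding norm_Hinf_def by (rule cSUP_upper[OF _ Hinf_bdd_above]) simp
  ultimately show ?thesis by (metis norm_zero order_trans)
qed

lemma Hinf_norm_least: "(\<And>z. z \<in> ball 0 1 \<Longrightarrow> cmod (Hinf_fun f z) \<le> b) \<Longrightarrow> norm f \<le> b"
  unfolding norm_Hinf_def by (rule cSUP_least) auto

instance
proof
  fix f g :: "'a Hinf" and r :: real
  show "norm f = 0 \<longleftrightarrow> f = 0"
  proof
    assume "norm f = 0"
    then have "Hinf_fun f z = 0" for z using Hinf_norm_le[of f z] by simp
    then show "f = 0" by (intro Hinf_eqI) (simp add: zero_Hinf.rep_eq)
  qed (simp add: norm_Hinf_def zero_Hinf.rep_eq)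
  show "norm (f + g) \<le> norm f + norm g"
    by (intro Hinf_norm_least)
      (auto simp: plus_Hinf.rep_eq intro!: norm_triangle_le add_mono Hinf_norm_le)
  have le: "norm (s *\<^sub>R h) \<le> \<bar>s\<bar> * norm h" for s and h :: "'a Hinf"
    by (intro Hinf_norm_least) (simp add: scaleR_Hinf.rep_eq mult_left_mono Hinf_norm_le)
  show "norm (r *\<^sub>R f) = \<bar>r\<bar> * norm f"
  proof (cases "r = 0")
    case True
    then show ?thesis by (simp add: norm_Hinf_def zero_Hinf.rep_eq)
  next
    case False
    then have "\<bar>r\<bar> * norm f = \<bar>r\<bar> * norm (inverse r *\<^sub>R r *\<^sub>R f)" by simp
    also have "\<dots> \<le> norm (r *\<^sub>R f)"
      using le[of "inverse r" "r *\<^sub>R f"] False by (simp add: field_simps abs_inverse)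
    finally show ?thesis using le[of r f] by simp
  qed
qed (simp_all add: dist_Hinf_def sgn_Hinf_def uniformity_Hinf_def open_Hinf_def)

end

instantiation Hinf :: (finite) complex_normed_vector
begin

lift_definition scaleC_Hinf :: "complex \<Rightarrow> 'a Hinf \<Rightarrow> 'a Hinf" is "\<lambda>c f z. c * f z"
  by (rule Hinf_set_scaleC)

instance
proof
  fix c d :: complex and f g :: "'a Hinf" and r :: real
  show "c *\<^sub>C (f + g) = c *\<^sub>C f + c *\<^sub>C g" "(c + d) *\<^sub>C f = c *\<^sub>C f + d *\<^sub>C f"
    "c *\<^sub>C d *\<^sub>C f = (c * d) *\<^sub>C f" "complex_of_real r *\<^sub>C f = r *\<^sub>R f"
    by (transfer; simp add: algebra_simps scaleR_conv_of_real)+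
  have le: "norm (e *\<^sub>C h) \<le> cmod e * norm h" for e and h :: "'a Hinf"
    by (intro Hinf_norm_least)
      (simp add: scaleC_Hinf.rep_eq norm_mult mult_left_mono Hinf_norm_le)
  show "norm (c *\<^sub>C f) = cmod c * norm f"
  proof (cases "c = 0")
    case True
    then show ?thesis by (simp add: norm_Hinf_def scaleC_Hinf.rep_eq)
  next
    case False
    have "f = inverse c *\<^sub>C c *\<^sub>C f"
      using False by transfer (simp add: fun_eq_iff)
    then have "norm f \<le> cmod (inverse c) * norm (c *\<^sub>C f)"
      using le[of "inverse c" "c *\<^sub>C f"] by simp
    then have "cmod c * norm f \<le> norm (c *\<^sub>C f)"
      using False by (simp add: norm_inverse norm_divide field_simps)
    then show ?thesis using le[of c f] by simp
  qed
qed

end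

section \<open>Composition operators\<close>

definition comp_op :: "(complex ^ 'n \<Rightarrow> complex ^ 'n) \<Rightarrow> 'n::finite Hinf \<Rightarrow> 'n Hinf"
  where "comp_op \<phi> f = Abs_Hinf (\<lambda>z. if z \<in> ball 0 1 then Hinf_fun f (\<phi> z) else 0)"

lemma comp_op_in_Hinf_set:
  fixes \<phi> :: "complex ^ 'n::finite \<Rightarrow> complex ^ 'n"
  assumes hol: "holomorphic_map_on \<phi> (ball 0 1)" and self: "\<phi> ` ball 0 1 \<subseteq> ball 0 1"
  shows "(\<lambda>z. if z \<in> ball 0 1 then Hinf_fun f (\<phi> z) else 0) \<in> Hinf_set" (is "?h \<in> _")
proof (rule Hinf_setI[where b = "norm f"])
  fix z :: "complex ^ 'n" assume z: "z \<in> ball 0 1"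
  obtain D where D: "bounded_clinear D" "(\<phi> has_derivative D) (at z)"
    using hol z unfolding holomorphic_map_on_def by blast
  have "\<phi> z \<in> ball 0 1" using self z by blast
  with Hinf_fun[of f]
  obtain E where E: "bounded_clinear E" "(Hinf_fun f has_derivative E) (at (\<phi> z))"
    by (rule Hinf_set_derivE)
  have "((\<lambda>z. Hinf_fun f (\<phi> z)) has_derivative (\<lambda>x. E (D x))) (at z)"
    using diff_chain_at[OF D(2) E(2)] by (simp add: o_def)
  then have "(?h has_derivative (\<lambda>x. E (D x))) (at z)"
    by (rule has_derivative_transform_within_open[OF _ open_ball z]) simp
  then show "\<exists>D. bounded_clinear D \<and> (?h has_derivative D) (at z)"
    using bounded_clinear_compose[OF E(1) D(1)] by blast
  show "cmod (?h z) \<le> norm f"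
    using z Hinf_norm_le[of f "\<phi> z"] by simp
qed simp

lemma comp_op_fun:
  fixes \<phi> :: "complex ^ 'n::finite \<Rightarrow> complex ^ 'n"
  assumes "holomorphic_map_on \<phi> (ball 0 1)" and "\<phi> ` ball 0 1 \<subseteq> ball 0 1"
  shows "z \<in> ball 0 1 \<Longrightarrow> Hinf_fun (comp_op \<phi> f) z = Hinf_fun f (\<phi> z)"
  using comp_op_in_Hinf_set[OF assms] by (simp add: comp_op_def Abs_Hinf_inverse)

lemma bounded_clinear_comp_op:
  fixes \<phi> :: "complex ^ 'n::finite \<Rightarrow> complex ^ 'n"
  assumes "holomorphic_map_on \<phi> (ball 0 1)" and "\<phi> ` ball 0 1 \<subseteq> ball 0 1"
  shows "bounded_clinear (comp_op \<phi>)"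
proof -
  have eq: "Hinf_fun (comp_op \<phi> f) z = (if z \<in> ball 0 1 then Hinf_fun f (\<phi> z) else 0)" for f z
    using comp_op_in_Hinf_set[OF assms] by (simp add: comp_op_def Abs_Hinf_inverse)
  have "bounded_linear (comp_op \<phi>)"
    by (rule bounded_linear_intro[where K = 1])
      (auto intro!: Hinf_eqI Hinf_norm_least
        simp: eq plus_Hinf.rep_eq scaleR_Hinf.rep_eq Hinf_norm_le)
  moreover have "comp_op \<phi> (c *\<^sub>C f) = c *\<^sub>C comp_op \<phi> f" for c f
    by (rule Hinf_eqI) (simp add: eq scaleC_Hinf.rep_eq)
  ultimately show ?thesis by (simp add: bounded_clinear_def)
qed

end

theory Submission
  imports Defs "HOL-Complex_Analysis.Complex_Analysis"
    "HOL-Computational_Algebra.Fundamental_Theorem_Algebra"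
begin

text \<open>Since the derivative at \<open>a\<close> has spectral radius below \<open>1\<close>, some iterate of \<open>\<phi>\<close> contracts near \<open>a\<close>.
  The iterates are equicontinuous by the Schwarz lemma, so the basin of \<open>a\<close> is open and closed in the
  ball; hence \<open>\<phi>\<^sub>j \<rightarrow> a\<close> uniformly on compact sets.

  If \<open>\<parallel>\<phi>\<^sub>j - a\<parallel>\<^sub>\<infinity> \<rightarrow> 0\<close>, the Schwarz lemma makes the powers of the composition operator converge in
  norm to evaluation at \<open>a\<close>, a rank-one operator. If some power is within distance less than \<open>1\<close> of a
  compact operator, the orbit of each coordinate function is relatively compact, and its only
  possible limit point is its value at \<open>a\<close>.

  If \<open>\<parallel>\<phi>\<^sub>j - a\<parallel>\<^sub>\<infinity>\<close> does not tend to \<open>0\<close>, every \<open>\<phi>\<^sub>k\<close> comes arbitrarily close to the sphere, so there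
  are \<open>z\<^sub>k\<close> with \<open>1 - \<bar>\<phi>\<^sub>i(z\<^sub>k)\<bar>\<close> summable over all \<open>1 \<le> i \<le> k\<close>. A product \<open>F\<close> of Blaschke factors vanishes
  at all points \<open>\<phi>\<^sub>i(z\<^sub>k)\<close> but not at \<open>a\<close>; the \<open>k\<close>-th Cesaro mean of \<open>F\<close> vanishes at \<open>z\<^sub>k\<close>, while the only
  possible limit of the means is the constant \<open>F(a)\<close>.\<close>

section \<open>Iterates of a matrix with spectrum in the unit disc\<close>

text \<open>Unrolling the recursion from an index where \<open>y\<close> has become small leaves a
  geometric term plus an error of at most \<open>e / 2\<close>. It is applied with \<open>q\<close>
  the modulus of an eigenvalue.\<close>

lemma tendsto_zero_recursion:
  fixes b y :: "nat \<Rightarrow> real"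
  assumes le: "\<And>j. b (Suc j) \<le> q * b j + y j" and nonneg: "\<And>j. 0 \<le> b j"
    and q: "0 \<le> q" "q < 1" and y: "y \<longlonglongrightarrow> 0"
  shows "b \<longlonglongrightarrow> 0"
proof (rule LIMSEQ_I)
  fix e :: real assume e: "0 < e"
  \<comment> \<open>This threshold makes \<open>e / 2\<close> the fixed point of the map sending t
    to \<open>q * t + (1 - q) * e / 2\<close>, so the error does not accumulate.\<close>
  have "\<forall>\<^sub>F j in sequentially. y j < (1 - q) * e / 2"
    using y q e by (intro order_tendstoD(2)) auto
  then obtain M where M: "\<And>j. j \<ge> M \<Longrightarrow> y j \<le> (1 - q) * e / 2"
    unfolding eventually_sequentially by (meson less_imp_le)
  have bound: "b (M + k) \<le> q ^ k * b M + e / 2" for k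
  proof (induction k)
    case (Suc k)
    have "b (M + Suc k) \<le> q * b (M + k) + y (M + k)" using le[of "M + k"] by simp
    also have "\<dots> \<le> q * (q ^ k * b M + e / 2) + (1 - q) * e / 2"
      using Suc M[of "M + k"] q by (intro add_mono mult_left_mono) auto
    also have "\<dots> = q ^ Suc k * b M + e / 2" by (simp add: field_simps)
    finally show ?case .
  qed (use e in simp)
  have "(\<lambda>k. q ^ k * b M) \<longlonglongrightarrow> 0"
    using q by (intro tendsto_mult_left_zero LIMSEQ_realpow_zero) auto
  then have "\<forall>\<^sub>F k in sequentially. q ^ k * b M < e / 2"
    using e by (intro order_tendstoD(2)) auto
  then obtain L where L: "\<And>k. k \<ge> L \<Longrightarrow> q ^ k * b M < e / 2"
    unfolding eventually_sequentially by blast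
  have "b j < e" if "j \<ge> M + L" for j
    using bound[of "j - M"] L[of "j - M"] that by force
  then show "\<exists>n0. \<forall>j\<ge>n0. norm (b j - 0) < e" using nonneg by auto
qed

text \<open>This is the vector p(A) v, computed by Horner's scheme directly on vectors, so that no
  polynomial in matrices has to be formed.\<close>

definition poly_act :: "complex ^ 'n ^ 'n \<Rightarrow> complex poly \<Rightarrow> complex ^ 'n \<Rightarrow> complex ^ 'n::finite"
  where "poly_act A p v = fold_coeffs (\<lambda>c w. c *s v + A *v w) p 0"

lemma poly_act_0 [simp]: "poly_act A 0 v = 0"
  by (simp add: poly_act_def)

lemma poly_act_pCons [simp]: "poly_act A (pCons c p) v = c *s v + A *v poly_act A p v"
  by (cases "c = 0 \<and> p = 0") (auto simp: poly_act_def)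

lemma poly_act_add: "poly_act A (p + q) v = poly_act A p v + poly_act A q v"
  by (induction p q rule: poly_induct2)
    (simp_all add: matrix_vector_right_distrib vec.scale_left_distrib algebra_simps)

lemma poly_act_smult: "poly_act A (smult c p) v = c *s poly_act A p v"
  by (induction p) (simp_all add: vector_smult_assoc vector_ssub_ldistrib vec.scale_right_distrib
      vec.scale vector_smult_rzero)

lemma poly_act_sum: "poly_act A (sum p I) v = (\<Sum>i\<in>I. poly_act A (p i) v)"
  by (induction I rule: infinite_finite_induct) (simp_all add: poly_act_add)

lemma poly_act_commute: "poly_act A p (A *v v) = A *v poly_act A p v"
  by (induction p) (simp_all add: matrix_vector_right_distrib vec.scale)

lemma poly_act_linear_factor:
  "poly_act A ([:- l, 1:] * q) v = A *v poly_act A q v - l *s poly_act A q v"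
proof -
  have "[:- l, 1:] * q = pCons 0 q + smult (- l) q" by simp
  then show ?thesis
    by (simp only: poly_act_add poly_act_smult poly_act_pCons) simp
qed

lemma poly_act_monom: "poly_act A (monom c i) v = c *s ((*v) A ^^ i) v"
  by (induction i) (simp_all add: monom_Suc monom_0 vec.scale)

text \<open>The orbit vectors up to exponent d, the real dimension of the space, are d + 1 in number
  and hence dependent over the reals. The coefficients of a dependence give the polynomial.\<close>

lemma exists_annihilating_poly:
  fixes A :: "complex ^ 'n ^ 'n::finite"
  shows "\<exists>p. p \<noteq> 0 \<and> poly_act A p v = 0"
\<comment> \<open>Dependence is a property of the set of vectors, so a repetition in the orbit is
  split off first; it yields a difference of two monomials.\<close>
proof (cases "inj (\<lambda>i. ((*v) A ^^ i) v)")
  case False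
  then obtain i j where ij: "i \<noteq> j" "((*v) A ^^ i) v = ((*v) A ^^ j) v"
    unfolding inj_def by blast
  have "coeff (monom (1::complex) i + monom (-1) j) i \<noteq> 0" using ij by (simp add: coeff_monom)
  then have "monom (1::complex) i + monom (-1) j \<noteq> 0" by (metis coeff_0)
  moreover have "poly_act A (monom 1 i + monom (-1) j) v = 0"
    using ij(2) by (simp add: poly_act_add poly_act_monom vec.scale_minus_left)
  ultimately show ?thesis by blast
next
  case inj: True
  let ?x = "\<lambda>i. ((*v) A ^^ i) v"
  define d where "d = DIM(complex ^ 'n)"
  have "dependent (?x ` {..d})"
    using card_image[OF inj_on_subset[OF inj], of "{..d}"]
    by (intro dependent_biggerset) (simp add: d_def)
  then obtain u where u: "\<exists>w\<in>?x ` {..d}. u w \<noteq> 0" "(\<Sum>w\<in>?x ` {..d}. u w *\<^sub>R w) = 0"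
    using real_vector.dependent_finite[of "?x ` {..d}"] by auto
  define p where "p = (\<Sum>i\<le>d. monom (complex_of_real (u (?x i))) i)"
  obtain i where i: "i \<le> d" "u (?x i) \<noteq> 0" using u(1) by auto
  have "coeff p i = u (?x i)"
    using i(1) by (simp add: p_def coeff_sum coeff_monom if_distrib cong: if_cong)
  then have "p \<noteq> 0" using i(2) by auto
  moreover have "poly_act A p v = (\<Sum>i\<le>d. u (?x i) *\<^sub>R ?x i)"
    unfolding p_def poly_act_sum poly_act_monom
    by (simp flip: scaleC_vec_complex add: scaleC_of_real)
  moreover have "\<dots> = 0"
    using u(2) inj_on_subset[OF inj] by (subst (asm) sum.reindex) (auto simp: o_def)
  ultimately show ?thesis by metis
qed

text \<open>Induction on the degree of a polynomial annihilating v. Split off a root l, so that p =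
  (X - l) q; then q(A) v is zero or an eigenvector for l. If l is outside the disc it must be zero,
  and q already annihilates v. Otherwise q annihilates w = A v - l v, so the iterates of w tend to
  0, and those of v satisfy a scalar recursion with factor \<open>cmod l\<close>. This replaces the
  Jordan normal form.\<close>

lemma linear_iterate_tendsto_zero:
  fixes A :: "complex ^ 'n ^ 'n::finite"
  assumes spec: "matrix_spectrum A \<subseteq> ball 0 1"
  shows "(\<lambda>j. ((*v) A ^^ j) v) \<longlonglongrightarrow> 0"
proof -
  have "(\<lambda>j. ((*v) A ^^ j) v) \<longlonglongrightarrow> 0" if "p \<noteq> 0" "poly_act A p v = 0" for p v
    using that
  proof (induction "degree p" arbitrary: p v)
    case 0
    then obtain c where "p = [:c:]" "c \<noteq> 0" by (metis degree_eq_zeroE pCons_0_0)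
    with 0 have "v = 0" by (simp add: vec_eq_iff)
    moreover have "((*v) A ^^ j) 0 = 0" for j by (induction j) auto
    ultimately show ?case by simp
  next
    case (Suc n)
    have "\<not> constant (poly p)" using Suc.hyps(2) by (simp add: constant_degree)
    then obtain l where "poly p l = 0" using fundamental_theorem_of_algebra by blast
    then obtain q where q: "p = [:- l, 1:] * q" by (auto simp: poly_eq_0_iff_dvd)
    have "q \<noteq> 0" using q Suc.prems by auto
    then have deg: "n = degree q" using Suc.hyps(2) unfolding q by (subst (asm) degree_mult_eq) auto
    have eq: "A *v poly_act A q v = l *s poly_act A q v"
      using Suc.prems(2) unfolding q poly_act_linear_factor by simp
    show ?case
    proof (cases "l \<in> ball 0 1")
      case False
      then have "poly_act A q v = 0" using eq spec unfolding matrix_spectrum_def by blast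
      then show ?thesis using Suc.hyps(1)[OF deg] \<open>q \<noteq> 0\<close> by blast
    next
      case l: True
      have pw: "((*v) A ^^ j) (u - c *s w) = ((*v) A ^^ j) u - c *s ((*v) A ^^ j) w" for j u w c
        by (induction j) (simp_all add: matrix_vector_mult_diff_distrib vec.scale)
      have "poly_act A q (A *v v - l *s v) = poly_act A q (A *v v) - l *s poly_act A q v"
      proof -
        have "poly_act A q (u - l *s w) = poly_act A q u - l *s poly_act A q w" for u w
          by (induction q) (simp_all add: matrix_vector_right_distrib vec.scale
              matrix_vector_mult_diff_distrib vec.scale_right_diff_distrib
              vec.scale_right_distrib mult.commute)
        then show ?thesis .
      qed
      then have "poly_act A q (A *v v - l *s v) = 0" using eq by (simp add: poly_act_commute)
      then have lim: "(\<lambda>j. ((*v) A ^^ j) (A *v v - l *s v)) \<longlonglongrightarrow> 0"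
        using Suc.hyps(1)[OF deg] \<open>q \<noteq> 0\<close> by blast
      have step: "((*v) A ^^ Suc j) v
          = l *s ((*v) A ^^ j) v + ((*v) A ^^ j) (A *v v - l *s v)" for j
        unfolding pw by (simp add: funpow_swap1)
      have "(\<lambda>j. norm (((*v) A ^^ j) v)) \<longlonglongrightarrow> 0"
      proof (rule tendsto_zero_recursion)
        show "norm (((*v) A ^^ Suc j) v)
            \<le> cmod l * norm (((*v) A ^^ j) v) + norm (((*v) A ^^ j) (A *v v - l *s v))" for j
          unfolding step by (metis norm_triangle_ineq norm_scaleC scaleC_vec_complex)
        show "(\<lambda>j. norm (((*v) A ^^ j) (A *v v - l *s v))) \<longlonglongrightarrow> 0"
          using lim by (rule tendsto_norm_zero)
      qed (use l in auto)
      then show ?thesis by (rule tendsto_norm_zero_cancel)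
    qed
  qed
  then show ?thesis using exists_annihilating_poly by blast
qed

text \<open>The operator norm is at most the sum of the norms of the images of the standard basis
  vectors, so pointwise convergence on this finite set suffices.\<close>

lemma linear_iterate_contraction:
  fixes A :: "complex ^ 'n ^ 'n::finite"
  assumes "matrix_spectrum A \<subseteq> ball 0 1" "0 < e"
  shows "\<exists>N. \<forall>v. norm (((*v) A ^^ N) v) \<le> e * norm v"
proof -
  let ?s = "\<lambda>j. \<Sum>i\<in>UNIV. norm (((*v) A ^^ j) (axis i 1))"
  have "?s \<longlonglongrightarrow> (\<Sum>i\<in>(UNIV::'n set). 0)"
    by (intro tendsto_sum tendsto_norm_zero linear_iterate_tendsto_zero assms)
  then have "\<forall>\<^sub>F j in sequentially. ?s j < e"
    using assms(2) by (intro order_tendstoD(2)[of _ 0]) auto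
  then obtain N where N: "?s N < e" by (auto simp: eventually_sequentially)
  have pw: "((*v) A ^^ j) (\<Sum>i\<in>I. c i *s w i) = (\<Sum>i\<in>I. c i *s ((*v) A ^^ j) (w i))"
    for j and I :: "'n set" and c w
    by (induction j) (simp_all add: vec.sum vec.scale)
  have "norm (((*v) A ^^ N) v) \<le> e * norm v" for v
  proof -
    have "((*v) A ^^ N) v = (\<Sum>i\<in>UNIV. v $ i *s ((*v) A ^^ N) (axis i 1))"
      by (subst basis_expansion[of v, symmetric]) (rule pw)
    also have "norm \<dots> \<le> (\<Sum>i\<in>UNIV. norm v * norm (((*v) A ^^ N) (axis i 1)))"
      by (rule sum_norm_le)
        (simp flip: scaleC_vec_complex add: norm_scaleC mult_right_mono Finite_Cartesian_Product.norm_nth_le)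
    also have "\<dots> \<le> e * norm v"
      using N by (simp flip: sum_distrib_left add: mult.commute[of e] mult_left_mono)
    finally show ?thesis .
  qed
  then show ?thesis by blast
qed

section \<open>Holomorphic maps on complex normed spaces\<close>

lemma bounded_linear_scaleC_left: "bounded_linear (\<lambda>c. c *\<^sub>C (v::'a::complex_normed_vector))"
proof (rule bounded_linear_intro[where K = "norm v"])
  show "(r *\<^sub>R c) *\<^sub>C v = r *\<^sub>R c *\<^sub>C v" for r and c :: complex
    by (simp only: scaleR_conv_of_real scaleC_scaleC[symmetric] scaleC_of_real)
qed (simp_all add: scaleC_add_left norm_scaleC)

lemma scaleC_zero_left [simp]: "0 *\<^sub>C (v::'a::complex_normed_vector) = 0"
  using norm_scaleC[of 0 v] by simp

lemma has_field_derivative_slice: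
  fixes f :: "'a::complex_normed_vector \<Rightarrow> complex"
  assumes "(f has_derivative D) (at (x + z *\<^sub>C v))" "bounded_clinear D"
  shows "((\<lambda>\<zeta>. f (x + \<zeta> *\<^sub>C v)) has_field_derivative D v) (at z)"
proof -
  have *: "((\<lambda>\<zeta>. x + \<zeta> *\<^sub>C v) has_derivative (\<lambda>\<zeta>. \<zeta> *\<^sub>C v)) (at z)"
    by (auto intro!: derivative_eq_intros bounded_linear.has_derivative[OF bounded_linear_scaleC_left])
  moreover have "(\<lambda>\<zeta>. D (\<zeta> *\<^sub>C v)) = (*) (D v)"
    using assms(2) by (simp add: bounded_clinear_def scaleC_complex_def fun_eq_iff)
  ultimately show ?thesis
    using has_derivative_compose[OF * assms(1)] unfolding has_field_derivative_def by simp
qed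

lemma holomorphic_on_slice:
  fixes f :: "'a::complex_normed_vector \<Rightarrow> complex"
  assumes f: "holomorphic_map_on f S" and S: "\<And>\<zeta>. \<zeta> \<in> T \<Longrightarrow> x + \<zeta> *\<^sub>C v \<in> S"
  shows "(\<lambda>\<zeta>. f (x + \<zeta> *\<^sub>C v)) holomorphic_on T"
  unfolding holomorphic_on_def
proof
  fix \<zeta> assume "\<zeta> \<in> T"
  then obtain D where "bounded_clinear D" "(f has_derivative D) (at (x + \<zeta> *\<^sub>C v))"
    using f S unfolding holomorphic_map_on_def by blast
  then show "(\<lambda>\<zeta>. f (x + \<zeta> *\<^sub>C v)) field_differentiable (at \<zeta> within T)"
    using has_field_derivative_slice field_differentiable_at_within field_differentiable_def by blast
qed

text \<open>Restrict f to the complex line through x, scale it so that the unit disc lands in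
  \<open>ball x d\<close>, subtract \<open>f x\<close> and divide by K. The two conclusions of the
  one-variable Schwarz lemma, on values and on the derivative at 0, become the two bounds.\<close>

lemma schwarz_on_slices:
  fixes f :: "'a::complex_normed_vector \<Rightarrow> complex"
  assumes f: "holomorphic_map_on f S" and S: "ball x d \<subseteq> S" and d: "0 < d"
    and bound: "\<And>y. y \<in> ball x d \<Longrightarrow> cmod (f y - f x) < K"
  shows schwarz_lipschitz: "y \<in> ball x d \<Longrightarrow> cmod (f y - f x) \<le> K / d * norm (y - x)"
    and schwarz_derivative: "(f has_derivative D) (at x) \<Longrightarrow> bounded_clinear D \<Longrightarrow>
      cmod (D h) \<le> K / d * norm h"
proof -
  have K: "0 < K" using bound[of x] d by simp
  \<comment> \<open>The direction of u stretched to length d. The value 0 at u = 0 makes the slice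
    constant there, so the formulas below also cover y = x and h = 0.\<close>
  define v where "v u = (if u = 0 then 0 else (d / norm u) *\<^sub>R u)" for u :: 'a
  have norm_v: "norm (v u) \<le> d" for u using d by (simp add: v_def)
  have u_eq: "u = complex_of_real (norm u / d) *\<^sub>C v u" for u
    unfolding scaleC_of_real using d by (simp add: v_def)
  define g where "g u \<zeta> = (f (x + \<zeta> *\<^sub>C v u) - f x) / K" for u \<zeta>
  have in_ball: "x + \<zeta> *\<^sub>C v u \<in> ball x d" if "cmod \<zeta> < 1" for \<zeta> u
  proof -
    have "cmod \<zeta> * norm (v u) < d"
    proof (cases "v u = 0")
      case False
      then have "cmod \<zeta> * norm (v u) < 1 * norm (v u)" using that by (intro mult_strict_right_mono) auto
      then show ?thesis using norm_v[of u] by simp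
    qed (use d in simp)
    then show ?thesis by (simp add: dist_norm norm_scaleC)
  qed
  have hol: "g u holomorphic_on ball 0 1" for u
    unfolding g_def using K in_ball S
    by (intro holomorphic_intros holomorphic_on_slice[OF f]) auto
  have g0: "g u 0 = 0" for u by (simp add: g_def)
  have g1: "cmod (g u \<zeta>) < 1" if "cmod \<zeta> < 1" for u \<zeta>
    using bound[OF in_ball[OF that]] K by (simp add: g_def norm_divide)
  note schwarz = Schwarz_Lemma[OF hol g0 g1]
  show "cmod (f y - f x) \<le> K / d * norm (y - x)" if y: "y \<in> ball x d"
  proof -
    let ?\<zeta> = "complex_of_real (norm (y - x) / d)"
    have "cmod ?\<zeta> < 1" using y d by (simp add: dist_norm norm_minus_commute norm_divide)
    from schwarz(1)[OF _ this, of "y - x"]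
    have "cmod (g (y - x) ?\<zeta>) \<le> norm (y - x) / d" using d by (simp add: norm_divide)
    moreover have "g (y - x) ?\<zeta> = (f y - f x) / K"
    proof -
      have "x + ?\<zeta> *\<^sub>C v (y - x) = y"
        using u_eq[of "y - x"] by (metis add.commute diff_add_cancel)
      then show ?thesis by (simp only: g_def)
    qed
    ultimately have "cmod ((f y - f x) / K) \<le> norm (y - x) / d" by simp
    then show ?thesis using K d by (simp add: norm_divide field_simps)
  qed
  show "cmod (D h) \<le> K / d * norm h" if D: "(f has_derivative D) (at x)" "bounded_clinear D"
  proof -
    have "(f has_derivative D) (at (x + 0 *\<^sub>C v h))" using D(1) by simp
    from has_field_derivative_slice[OF this D(2)]
    have "(g h has_field_derivative D (v h) / K) (at 0)"
      unfolding g_def using K by (auto intro!: derivative_eq_intros)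
    then have "cmod (D (v h) / K) \<le> 1" using schwarz(2)[of 0 h] by (simp add: DERIV_imp_deriv)
    then have *: "cmod (D (v h)) \<le> K" using K by (simp add: norm_divide)
    have "D h = complex_of_real (norm h / d) * D (v h)"
      using D(2) u_eq[of h] unfolding bounded_clinear_def scaleC_complex_def by metis
    then have "cmod (D h) = norm h / d * cmod (D (v h))" using d by (simp add: norm_mult norm_divide)
    also have "\<dots> \<le> norm h / d * K" using * d by (intro mult_left_mono) auto
    finally show ?thesis by (simp add: mult.commute)
  qed
qed

section \<open>Locally uniform limits of holomorphic functions\<close>

lemma bounded_clinear_diff:
  assumes "bounded_clinear S" "bounded_clinear T"
  shows "bounded_clinear (\<lambda>x. S x - T x)"
proof -
  have "(- 1) *\<^sub>C T x = - T x" for x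
    using scaleC_of_real[of "-1" "T x"] by simp
  then show ?thesis
    using bounded_clinear_add[OF assms(1) bounded_clinear_scaleC[OF assms(2), of "-1"]] by simp
qed

lemma holomorphic_map_on_diff:
  assumes "holomorphic_map_on f S" "holomorphic_map_on g S"
  shows "holomorphic_map_on (\<lambda>z. f z - g z) S"
  unfolding holomorphic_map_on_def
proof (intro conjI ballI)
  fix z assume z: "z \<in> S"
  obtain D E where "bounded_clinear D" "(f has_derivative D) (at z)"
    "bounded_clinear E" "(g has_derivative E) (at z)"
    using assms z unfolding holomorphic_map_on_def by blast
  then show "\<exists>D. bounded_clinear D \<and> ((\<lambda>z. f z - g z) has_derivative D) (at z)"
    using bounded_clinear_diff has_derivative_diff by blast
qed (use assms in \<open>simp add: holomorphic_map_on_def\<close>)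

text \<open>The Schwarz bound on derivatives turns the uniform Cauchy property of the functions into
  one for their derivatives on a smaller ball. The theorem on differentiating a sequence term by
  term then applies.\<close>

lemma holomorphic_map_on_uniform_limit:
  fixes F :: "nat \<Rightarrow> 'a::complex_normed_vector \<Rightarrow> complex"
  assumes S: "open S" and F: "\<And>n. holomorphic_map_on (F n) S"
    and lim: "\<And>x. x \<in> S \<Longrightarrow> \<exists>d>0. ball x d \<subseteq> S \<and> uniform_limit (ball x d) F f sequentially"
  shows "holomorphic_map_on f S"
  unfolding holomorphic_map_on_def
proof (intro conjI ballI)
  fix x0 assume "x0 \<in> S"
  then obtain d where d: "0 < d" "ball x0 d \<subseteq> S" and ul: "uniform_limit (ball x0 d) F f sequentially"
    using lim by blast
  \<comment> \<open>Halving the radius leaves a ball of radius \<open>d / 2\<close> around every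
    point of U on which convergence is uniform.\<close>
  define U where "U = ball x0 (d / 2)"
  have U: "convex U" "x0 \<in> U" "open U" using d by (auto simp: U_def)
  have sub: "ball x (d / 2) \<subseteq> ball x0 d" if "x \<in> U" for x
  proof
    fix y assume "y \<in> ball x (d / 2)"
    then show "y \<in> ball x0 d" using that dist_triangle[of x0 y x] by (simp add: U_def)
  qed
  have Ux0: "x \<in> ball x0 d" if "x \<in> U" for x
  proof -
    have "x \<in> ball x (d / 2)" using d by simp
    then show ?thesis using sub[OF that] d by blast
  qed
  have "\<forall>n x. \<exists>D. x \<in> U \<longrightarrow> bounded_clinear D \<and> (F n has_derivative D) (at x)"
    using F Ux0 d unfolding holomorphic_map_on_def by blast
  then obtain F' where F': "\<And>n x. x \<in> U \<Longrightarrow> bounded_clinear (F' n x)"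
      "\<And>n x. x \<in> U \<Longrightarrow> (F n has_derivative F' n x) (at x)"
    by metis
  have cauchy: "\<exists>N. \<forall>m\<ge>N. \<forall>n\<ge>N. \<forall>x\<in>U. \<forall>h. cmod (F' m x h - F' n x h) \<le> e * norm h"
    if "0 < e" for e
  proof -
    \<comment> \<open>Four errors below k add up to less than \<open>5 * k\<close>; division by the
      radius \<open>d / 2\<close> gives exactly e.\<close>
    define k where "k = e * d / 10"
    have k: "0 < k" using that d by (simp add: k_def)
    from uniform_limitD[OF ul k] obtain N
      where N: "\<And>n y. n \<ge> N \<Longrightarrow> y \<in> ball x0 d \<Longrightarrow> dist (F n y) (f y) < k"
      unfolding eventually_sequentially by blast
    have "cmod (F' m x h - F' n x h) \<le> e * norm h" if mn: "m \<ge> N" "n \<ge> N" and x: "x \<in> U" for m n x h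
    proof -
      have "cmod ((F m y - F n y) - (F m x - F n x)) < 5 * k" if y: "y \<in> ball x (d / 2)" for y
      proof -
        have "y \<in> ball x0 d" "x \<in> ball x0 d" using sub[OF x] y Ux0[OF x] by blast+
        then have *: "cmod (F m y - f y) < k" "cmod (F n y - f y) < k"
          "cmod (F m x - f x) < k" "cmod (F n x - f x) < k"
          using N mn by (auto simp: dist_norm)
        have "(F m y - F n y) - (F m x - F n x)
          = ((F m y - f y) - (F n y - f y)) - ((F m x - f x) - (F n x - f x))" by simp
        also have "cmod \<dots> \<le> (cmod (F m y - f y) + cmod (F n y - f y))
            + (cmod (F m x - f x) + cmod (F n x - f x))"
          by (meson norm_triangle_ineq4 add_mono order_trans)
        finally show ?thesis using * k by linarith
      qed
      then have "cmod (F' m x h - F' n x h) \<le> (5 * k) / (d / 2) * norm h"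
        using d sub[OF x]
        by (intro schwarz_derivative[OF holomorphic_map_on_diff[OF F[of m] F[of n]]])
          (auto intro!: has_derivative_diff bounded_clinear_diff F' x)
      also have "\<dots> = e * norm h" using d by (simp add: k_def)
      finally show ?thesis .
    qed
    then show ?thesis by blast
  qed
  have conv: "convergent (\<lambda>n. F' n x h)" if x: "x \<in> U" for x h
    unfolding Cauchy_convergent_iff[symmetric]
  proof (rule CauchyI)
    fix e :: real assume e: "0 < e"
    \<comment> \<open>The summand 1 keeps the denominator positive when h = 0.\<close>
    define e' where "e' = e / (norm h + 1)"
    have "0 < e'" using e by (simp add: e'_def add_nonneg_pos)
    from cauchy[OF this] obtain N
      where N: "\<And>m n. m \<ge> N \<Longrightarrow> n \<ge> N \<Longrightarrow> cmod (F' m x h - F' n x h) \<le> e' * norm h" using x by blast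
    have "e' * norm h < e" using e by (simp add: e'_def divide_simps add_nonneg_pos)
    then show "\<exists>M. \<forall>m\<ge>M. \<forall>n\<ge>M. cmod (F' m x h - F' n x h) < e"
      using N by (meson le_less_trans)
  qed
  define g' where "g' x h = lim (\<lambda>n. F' n x h)" for x h
  have g': "(\<lambda>n. F' n x h) \<longlonglongrightarrow> g' x h" if "x \<in> U" for x h
    using conv[OF that] by (simp add: g'_def convergent_LIMSEQ_iff)
  have "\<exists>g. \<forall>x\<in>U. (\<lambda>n. F n x) \<longlonglongrightarrow> g x \<and> (g has_derivative g' x) (at x within U)"
  proof (rule has_derivative_sequence[OF U(1) _ _ U(2)])
    show "(F n has_derivative F' n x) (at x within U)" if "x \<in> U" for n x
      using F'(2)[OF that] by (rule has_derivative_at_withinI)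
    show "(\<lambda>n. F n x0) \<longlonglongrightarrow> f x0" using tendsto_uniform_limitI[OF ul] d by simp
    show "\<forall>\<^sub>F n in sequentially. \<forall>x\<in>U. \<forall>h. cmod (F' n x h - g' x h) \<le> e * norm h" if e: "0 < e" for e
    proof -
      from cauchy[OF e] obtain N where N: "\<And>m n x h. m \<ge> N \<Longrightarrow> n \<ge> N \<Longrightarrow> x \<in> U \<Longrightarrow>
          cmod (F' m x h - F' n x h) \<le> e * norm h" by blast
      have "cmod (F' m x h - g' x h) \<le> e * norm h" if "m \<ge> N" "x \<in> U" for m x h
        using N that
        by (intro Lim_bounded[OF tendsto_norm[OF tendsto_diff[OF tendsto_const g'[OF that(2)]]], of N]) auto
      then show ?thesis unfolding eventually_sequentially by blast
    qed
  qed
  then obtain g where g: "\<And>x. x \<in> U \<Longrightarrow> (\<lambda>n. F n x) \<longlonglongrightarrow> g x"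
    "\<And>x. x \<in> U \<Longrightarrow> (g has_derivative g' x) (at x within U)" by blast
  have "g x = f x" if "x \<in> U" for x
    using LIMSEQ_unique[OF g(1)[OF that] tendsto_uniform_limitI[OF ul Ux0[OF that]]] .
  moreover have "(g has_derivative g' x0) (at x0)"
    using g(2)[OF U(2)] at_within_open[OF U(2,3)] by simp
  ultimately have D: "(f has_derivative g' x0) (at x0)"
    using has_derivative_transform_within_open[OF _ U(3,2)] by blast
  \<comment> \<open>The limit theorem yields a real derivative only; complex homogeneity is
    inherited from the approximating derivatives.\<close>
  have "g' x0 (c *\<^sub>C h) = c *\<^sub>C g' x0 h" for c h
  proof -
    have "(\<lambda>n. F' n x0 (c *\<^sub>C h)) = (\<lambda>n. c * F' n x0 h)"
      using F'(1)[OF U(2)] by (simp add: bounded_clinear_def scaleC_complex_def)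
    with g'[OF U(2), of "c *\<^sub>C h"] tendsto_mult_left[OF g'[OF U(2), of h], of c]
    show ?thesis by (simp add: scaleC_complex_def LIMSEQ_unique)
  qed
  then have "bounded_clinear (g' x0)"
    using has_derivative_bounded_linear[OF D] by (simp add: bounded_clinear_def)
  with D show "\<exists>D. bounded_clinear D \<and> (f has_derivative D) (at x0)" by blast
qed (rule S)

lemma holomorphic_component:
  fixes f :: "'a::complex_normed_vector \<Rightarrow> complex ^ 'n::finite"
  assumes "holomorphic_map_on f S"
  shows "holomorphic_map_on (\<lambda>z. f z $ i) S"
  unfolding holomorphic_map_on_def
proof (intro conjI ballI)
  fix z assume z: "z \<in> S"
  obtain D where D: "bounded_clinear D" "(f has_derivative D) (at z)"
    using assms z unfolding holomorphic_map_on_def by blast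
  have "bounded_clinear (\<lambda>x. D x $ i)"
    using D(1) bounded_linear_compose[OF bounded_linear_vec_nth, of D]
    by (auto simp: bounded_clinear_def scaleC_vec_def)
  moreover have "((\<lambda>z. f z $ i) has_derivative (\<lambda>x. D x $ i)) (at z)"
    by (rule bounded_linear.has_derivative[OF bounded_linear_vec_nth D(2)])
  ultimately show "\<exists>D. bounded_clinear D \<and> ((\<lambda>z. f z $ i) has_derivative D) (at z)" by blast
qed (use assms in \<open>simp add: holomorphic_map_on_def\<close>)

lemma ball_subset_unit_ball:
  fixes x :: "'a::real_normed_vector"
  shows "ball x (1 - norm x) \<subseteq> ball 0 1"
proof
  fix y assume "y \<in> ball x (1 - norm x)"
  then show "y \<in> ball 0 1"
    using norm_triangle_sub[of y x] by (simp add: dist_norm norm_minus_commute)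
qed

lemma compact_subset_unit_ball:
  fixes K :: "'a::real_normed_vector set"
  assumes "compact K" "K \<subseteq> ball 0 1"
  obtains r where "r < 1" "K \<subseteq> cball 0 r"
proof (cases "K = {}")
  case False
  obtain x where x: "x \<in> K" "\<And>y. y \<in> K \<Longrightarrow> norm y \<le> norm x"
    using continuous_attains_sup[OF assms(1) False continuous_on_norm_id] by auto
  have "norm x < 1" using x assms(2) by auto
  then show ?thesis
    using x by (intro that[of "norm x"]) auto
qed (use that[of 0] in auto)

section \<open>Iterates of a self-map with an attracting fixed point\<close>

locale ball_self_map =
  fixes \<phi> :: "complex ^ 'n::finite \<Rightarrow> complex ^ 'n"
  assumes hol: "holomorphic_map_on \<phi> (ball 0 1)" and self: "\<phi> ` ball 0 1 \<subseteq> ball 0 1"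
begin

lemma iterate_in_ball: "z \<in> ball 0 1 \<Longrightarrow> (\<phi> ^^ j) z \<in> ball 0 1"
  using self by (induction j) (auto simp: image_subset_iff)

lemma holomorphic_iterate: "holomorphic_map_on (\<phi> ^^ j) (ball 0 1)"
proof (induction j)
  case 0
  have "bounded_clinear (\<lambda>x::complex ^ 'n. x)" by (simp add: bounded_clinear_def bounded_linear_ident)
  then show ?case
    unfolding holomorphic_map_on_def by (auto simp: id_def intro!: exI[of _ "\<lambda>x. x"] has_derivative_ident)
next
  case (Suc j)
  show ?case unfolding holomorphic_map_on_def
  proof (intro conjI ballI)
    fix z :: "complex ^ 'n" assume z: "z \<in> ball 0 1"
    obtain D where D: "bounded_clinear D" "(\<phi> ^^ j has_derivative D) (at z)"
      using Suc z unfolding holomorphic_map_on_def by blast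
    obtain E where E: "bounded_clinear E" "(\<phi> has_derivative E) (at ((\<phi> ^^ j) z))"
      using hol iterate_in_ball[OF z] unfolding holomorphic_map_on_def by blast
    show "\<exists>D. bounded_clinear D \<and> (\<phi> ^^ Suc j has_derivative D) (at z)"
      using bounded_clinear_compose[OF E(1) D(1)] diff_chain_at[OF D(2) E(2)]
      by (auto simp: o_def)
  qed simp
qed

lemma continuous_on_iterate: "continuous_on (ball 0 1) (\<phi> ^^ j)"
  using holomorphic_iterate[of j] unfolding holomorphic_map_on_def
  by (meson continuous_at_imp_continuous_on has_derivative_continuous)

lemma comp_op_funpow:
  "z \<in> ball 0 1 \<Longrightarrow> Hinf_fun ((comp_op \<phi> ^^ j) f) z = Hinf_fun f ((\<phi> ^^ j) z)"
proof (induction j arbitrary: z)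
  case (Suc j)
  then have "\<phi> z \<in> ball 0 1" using self by blast
  then have "Hinf_fun ((comp_op \<phi> ^^ Suc j) f) z = Hinf_fun f ((\<phi> ^^ j) (\<phi> z))"
    using Suc comp_op_fun[OF hol self] by simp
  then show ?case by (simp add: funpow_swap1)
qed simp

text \<open>All iterates map the ball into itself, so their coordinates share one bound, and the
  Schwarz lemma gives a Lipschitz constant independent of j.\<close>

lemma iterates_equicontinuous:
  assumes x: "x \<in> ball 0 1"
  obtains L where "0 < L"
    "\<And>j y. y \<in> ball x (1 - norm x) \<Longrightarrow> norm ((\<phi> ^^ j) y - (\<phi> ^^ j) x) \<le> L * norm (y - x)"
proof
  let ?d = "1 - norm x"
  have d: "0 < ?d" using x by simp
  note sub = ball_subset_unit_ball[of x]
  \<comment> \<open>Each coordinate varies by less than 3 on a ball of radius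
    \<open>1 - norm x\<close>; summing over the coordinates gives the factor
    \<open>CARD('n)\<close>.\<close>
  show "0 < real CARD('n) * (3 / ?d)" using d by simp
  fix j y assume y: "y \<in> ball x ?d"
  have "cmod ((\<phi> ^^ j) y $ i - (\<phi> ^^ j) x $ i) \<le> 3 / ?d * norm (y - x)" for i
  proof (rule schwarz_lipschitz[OF holomorphic_component[OF holomorphic_iterate] sub d _ y])
    fix w assume "w \<in> ball x ?d"
    then have "norm ((\<phi> ^^ j) w) < 1" "norm ((\<phi> ^^ j) x) < 1" using sub iterate_in_ball x by fastforce+
    then have "cmod ((\<phi> ^^ j) w $ i) < 1" "cmod ((\<phi> ^^ j) x $ i) < 1"
      by (meson Finite_Cartesian_Product.norm_nth_le le_less_trans)+
    then show "cmod ((\<phi> ^^ j) w $ i - (\<phi> ^^ j) x $ i) < 3"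
      using norm_triangle_ineq4[of "(\<phi> ^^ j) w $ i" "(\<phi> ^^ j) x $ i"] by linarith
  qed
  then have "(\<Sum>i\<in>UNIV. norm (((\<phi> ^^ j) y - (\<phi> ^^ j) x) $ i)) \<le> (\<Sum>i\<in>(UNIV::'n set). 3 / ?d * norm (y - x))"
    by (intro sum_mono) simp
  then show "norm ((\<phi> ^^ j) y - (\<phi> ^^ j) x) \<le> real CARD('n) * (3 / ?d) * norm (y - x)"
    using L2_set_le_sum[of UNIV "\<lambda>i. norm (((\<phi> ^^ j) y - (\<phi> ^^ j) x) $ i)"]
    by (simp add: norm_vec_def)
qed

end

locale attracting_self_map = ball_self_map \<phi> for \<phi> :: "complex ^ 'n::finite \<Rightarrow> complex ^ 'n" +
  fixes a :: "complex ^ 'n"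
  assumes a: "a \<in> ball 0 1" and fixpoint: "\<phi> a = a"
    and spectrum: "matrix_spectrum (jacobian \<phi> (at a)) \<subseteq> ball 0 1"
begin

section \<open>Attraction of the iterates to the fixed point\<close>

lemma iterate_fixpoint [simp]: "(\<phi> ^^ j) a = a"
  by (induction j) (simp_all add: fixpoint)

lemma iterate_has_derivative:
  "((\<phi> ^^ j) has_derivative ((*v) (jacobian \<phi> (at a)) ^^ j)) (at a)"
proof (induction j)
  case 0
  show ?case by (simp add: id_def has_derivative_ident)
next
  case (Suc j)
  have "(\<phi> has_derivative (*v) (jacobian \<phi> (at a))) (at ((\<phi> ^^ j) a))"
    using holomorphic_map_on_jacobian[OF hol a] by simp
  from diff_chain_at[OF Suc this] show ?case unfolding funpow.simps .
qed

text \<open>Some power N of the derivative has norm at most 1/4. Allowing another 1/4 for the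
  linearisation error, \<open>\<phi> ^^ N\<close> halves distances to a near a. A general exponent
  is split by division by N, and the remaining iterates cost only the common Lipschitz
  constant.\<close>

lemma local_attraction:
  obtains \<rho> where "0 < \<rho>"
    "\<And>e. 0 < e \<Longrightarrow> \<exists>J. \<forall>j\<ge>J. \<forall>z\<in>ball a \<rho>. norm ((\<phi> ^^ j) z - a) < e"
proof -
  let ?A = "jacobian \<phi> (at a)"
  obtain N where N: "\<And>v. norm (((*v) ?A ^^ N) v) \<le> 1/4 * norm v"
    using linear_iterate_contraction[OF spectrum, of "1/4"] by auto
  \<comment> \<open>The exponent N will be a divisor; N = 0 would make the identity contract a
    nonzero vector.\<close>
  have "0 < N"
  proof (rule ccontr)
    assume "\<not> 0 < N"
    then show False using N[of "axis undefined 1"] by simp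
  qed
  obtain d where d: "0 < d"
    "\<And>y. norm (y - a) < d \<Longrightarrow> norm ((\<phi> ^^ N) y - a - ((*v) ?A ^^ N) (y - a)) \<le> 1/4 * norm (y - a)"
    using iterate_has_derivative[of N] unfolding has_derivative_at_alt
    by (metis iterate_fixpoint less_divide_eq_numeral1(1) mult_zero_left zero_less_one)
  obtain L where L: "0 < L"
    "\<And>j y. y \<in> ball a (1 - norm a) \<Longrightarrow> norm ((\<phi> ^^ j) y - (\<phi> ^^ j) a) \<le> L * norm (y - a)"
    using iterates_equicontinuous[OF a] by blast
  \<comment> \<open>Inside both the range of the linearisation estimate and the ball of the
    Lipschitz estimate.\<close>
  define \<rho> where "\<rho> = min d (1 - norm a)"
  have \<rho>: "0 < \<rho>" using d a by (simp add: \<rho>_def)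
  have half: "norm ((\<phi> ^^ N) y - a) \<le> 1/2 * norm (y - a)" if "norm (y - a) < \<rho>" for y
    using d(2)[of y] N[of "y - a"] that
      norm_triangle_sub[of "(\<phi> ^^ N) y - a" "((*v) ?A ^^ N) (y - a)"] by (simp add: \<rho>_def)
  have pow: "norm ((\<phi> ^^ (N * k)) y - a) \<le> (1/2) ^ k * norm (y - a)" if y: "norm (y - a) < \<rho>" for y k
  proof (induction k)
    case (Suc k)
    have "(1/2) ^ k * norm (y - a) \<le> 1 * norm (y - a)"
      by (intro mult_right_mono power_le_one) auto
    then have "norm ((\<phi> ^^ (N * k)) y - a) < \<rho>" using Suc y by linarith
    from half[OF this] Suc show ?case
      by (simp add: funpow_add mult.commute)
  qed simp
  show ?thesis
  proof (rule that[OF \<rho>])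
    fix e :: real assume e: "0 < e"
    have "(\<lambda>k. L * ((1/2) ^ k * \<rho>)) \<longlonglongrightarrow> L * (0 * \<rho>)"
      by (intro tendsto_intros LIMSEQ_realpow_zero) auto
    then have "\<forall>\<^sub>F k in sequentially. L * ((1/2) ^ k * \<rho>) < e"
      using e by (intro order_tendstoD(2)) auto
    then obtain M where M: "\<And>k. k \<ge> M \<Longrightarrow> L * ((1/2) ^ k * \<rho>) < e"
      unfolding eventually_sequentially by blast
    have "norm ((\<phi> ^^ j) z - a) < e" if j: "j \<ge> N * M" and z: "z \<in> ball a \<rho>" for j z
    proof -
      let ?k = "j div N" and ?y = "(\<phi> ^^ (N * (j div N))) z"
      have k: "?k \<ge> M" using j \<open>0 < N\<close> by (metis div_le_mono nonzero_mult_div_cancel_left not_gr0)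
      have z': "norm (z - a) < \<rho>" using z by (simp add: dist_norm norm_minus_commute)
      have "norm (?y - a) \<le> (1/2) ^ ?k * norm (z - a)" by (rule pow[OF z'])
      also have "\<dots> \<le> (1/2) ^ ?k * \<rho>" using z' by (intro mult_left_mono) auto
      finally have y: "norm (?y - a) \<le> (1/2) ^ ?k * \<rho>" .
      have "norm (?y - a) \<le> norm (z - a)"
      proof -
        have "(1/2) ^ ?k * norm (z - a) \<le> 1 * norm (z - a)"
          by (intro mult_right_mono power_le_one) auto
        then show ?thesis using pow[OF z', of ?k] by linarith
      qed
      then have "?y \<in> ball a (1 - norm a)"
        using z' by (simp add: \<rho>_def dist_norm norm_minus_commute)
      from L(2)[OF this, of "j mod N"]
      have "norm ((\<phi> ^^ (j mod N)) ?y - a) \<le> L * norm (?y - a)" by simp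
      also have "\<dots> \<le> L * ((1/2) ^ ?k * \<rho>)" using y L(1) by (intro mult_left_mono) auto
      also have "\<dots> < e" by (rule M[OF k])
      finally have "norm ((\<phi> ^^ (j mod N + N * (j div N))) z - a) < e" by (simp only: funpow_add o_apply)
      then show ?thesis by simp
    qed
    then show "\<exists>J. \<forall>j\<ge>J. \<forall>z\<in>ball a \<rho>. norm ((\<phi> ^^ j) z - a) < e" by blast
  qed
qed

text \<open>Membership in the basin, the set of points whose orbit enters
  \<open>ball a \<rho>\<close>, is locally constant by equicontinuity, so by connectedness every
  point of the ball belongs to it. On a compact set a finite subcover bounds the entrance
  time.\<close>

lemma uniform_attraction_on_compact:
  assumes K: "compact K" "K \<subseteq> ball 0 1" and e: "0 < e"
  shows "\<exists>J. \<forall>j\<ge>J. \<forall>z\<in>K. norm ((\<phi> ^^ j) z - a) < e"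
proof -
  obtain \<rho> where \<rho>: "0 < \<rho>"
    "\<And>e. 0 < e \<Longrightarrow> \<exists>J. \<forall>j\<ge>J. \<forall>z\<in>ball a \<rho>. norm ((\<phi> ^^ j) z - a) < e"
    using local_attraction by blast
  define basin where "basin z \<longleftrightarrow> (\<exists>m. (\<phi> ^^ m) z \<in> ball a \<rho>)" for z
  \<comment> \<open>Waiting until the orbit of x is within \<open>\<rho> / 2\<close> of a leaves
    \<open>\<rho> / 2\<close> for the distance between the two orbits.\<close>
  have near: "basin y" if "basin x" "\<And>j. norm ((\<phi> ^^ j) y - (\<phi> ^^ j) x) < \<rho> / 2" for x y
  proof -
    obtain m where m: "(\<phi> ^^ m) x \<in> ball a \<rho>" using \<open>basin x\<close> by (auto simp: basin_def)
    obtain J where "norm ((\<phi> ^^ J) ((\<phi> ^^ m) x) - a) < \<rho> / 2"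
      using \<rho>(2)[of "\<rho> / 2"] \<rho>(1) m by fastforce
    then have "norm ((\<phi> ^^ (J + m)) x - a) < \<rho> / 2" by (simp add: funpow_add)
    then have "norm ((\<phi> ^^ (J + m)) y - a) < \<rho>"
      using that(2)[of "J + m"] norm_triangle_ineq[of "(\<phi> ^^ (J + m)) y - (\<phi> ^^ (J + m)) x" "(\<phi> ^^ (J + m)) x - a"]
      by simp
    then show ?thesis by (auto simp: basin_def dist_norm norm_minus_commute)
  qed
  have basin: "basin z" if z: "z \<in> ball 0 1" for z
  proof -
    have "basin z = basin a"
    proof (rule connected_local_const[of "ball 0 1"])
      show "\<forall>x\<in>ball 0 1. \<forall>\<^sub>F y in at x within ball 0 1. basin x = basin y"
      proof
        fix x :: "complex ^ 'n" assume x: "x \<in> ball 0 1"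
        obtain L where L: "0 < L" "\<And>j y. y \<in> ball x (1 - norm x) \<Longrightarrow>
            norm ((\<phi> ^^ j) y - (\<phi> ^^ j) x) \<le> L * norm (y - x)"
          using iterates_equicontinuous[OF x] by blast
        define \<delta> where "\<delta> = min (1 - norm x) (\<rho> / (2 * L))"
        have \<delta>: "0 < \<delta>" using x \<rho> L by (simp add: \<delta>_def)
        have "basin x = basin y" if y: "dist y x < \<delta>" for y
        proof -
          have "norm ((\<phi> ^^ j) y - (\<phi> ^^ j) x) < \<rho> / 2" for j
          proof -
            have "norm ((\<phi> ^^ j) y - (\<phi> ^^ j) x) \<le> L * norm (y - x)"
              using y by (intro L(2)) (simp add: \<delta>_def dist_commute)
            also have "\<dots> < L * (\<rho> / (2 * L))"
              using y L(1) by (intro mult_strict_left_mono) (auto simp: \<delta>_def dist_norm)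
            finally show ?thesis using L(1) by simp
          qed
          \<comment> \<open>The distance between orbits is symmetric, so both the basin and its
            complement are open in the ball.\<close>
          then show ?thesis using near[of x y] near[of y x] by (auto simp: norm_minus_commute)
        qed
        then show "\<forall>\<^sub>F y in at x within ball 0 1. basin x = basin y"
          using \<delta> unfolding eventually_at by blast
      qed
    qed (use z a in auto)
    moreover have "basin a" using \<rho>(1) by (auto simp: basin_def)
    ultimately show ?thesis by simp
  qed
  define U where "U m = ball 0 1 \<inter> (\<phi> ^^ m) -` ball a \<rho>" for m
  have "open (U m)" for m
    unfolding U_def by (rule continuous_open_preimage[OF continuous_on_iterate]) auto
  moreover have "K \<subseteq> (\<Union>m. U m)" using basin K(2) by (auto simp: U_def basin_def)
  ultimately obtain C where C: "finite C" "K \<subseteq> (\<Union>m\<in>C. U m)"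
    using compactE_image[OF K(1), of UNIV U] by auto
  obtain J where J: "\<And>j z. j \<ge> J \<Longrightarrow> z \<in> ball a \<rho> \<Longrightarrow> norm ((\<phi> ^^ j) z - a) < e"
    using \<rho>(2)[OF e] by blast
  \<comment> \<open>The inserted 0 keeps \<open>Max\<close> meaningful when C is empty.\<close>
  have "norm ((\<phi> ^^ j) z - a) < e" if j: "j \<ge> J + Max (insert 0 C)" and z: "z \<in> K" for j z
  proof -
    obtain m where m: "m \<in> C" "(\<phi> ^^ m) z \<in> ball a \<rho>" using C z by (auto simp: U_def)
    have "m \<le> Max (insert 0 C)" using m C by simp
    then have "norm ((\<phi> ^^ (j - m)) ((\<phi> ^^ m) z) - a) < e" using j m by (intro J) auto
    moreover have "(\<phi> ^^ (j - m)) ((\<phi> ^^ m) z) = (\<phi> ^^ j) z"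
      using \<open>m \<le> _\<close> j by (simp flip: funpow_add o_apply[of "\<phi> ^^ (j - m)"])
    ultimately show ?thesis by simp
  qed
  then show ?thesis by blast
qed

lemma pointwise_attraction:
  assumes "z \<in> ball 0 1"
  shows "(\<lambda>j. (\<phi> ^^ j) z) \<longlonglongrightarrow> a"
proof (rule LIMSEQ_I)
  fix e :: real assume "0 < e"
  then show "\<exists>J. \<forall>j\<ge>J. norm ((\<phi> ^^ j) z - a) < e"
    using uniform_attraction_on_compact[of "{z}" e] assms by auto
qed

text \<open>Statement (iii) with the supremum expanded into pointwise bounds; all other statements
  are compared with this form.\<close>

definition uniform_attraction :: bool
  where "uniform_attraction \<longleftrightarrow> (\<forall>e>0. \<exists>J. \<forall>j\<ge>J. \<forall>z\<in>ball 0 1. norm ((\<phi> ^^ j) z - a) \<le> e)"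

lemma uniform_attraction_iff_SUP:
  "(\<lambda>j. SUP z\<in>ball 0 1. norm ((\<phi> ^^ j) z - a)) \<longlonglongrightarrow> 0 \<longleftrightarrow> uniform_attraction"
proof -
  let ?s = "\<lambda>j. SUP z\<in>ball 0 1. norm ((\<phi> ^^ j) z - a)"
  \<comment> \<open>A real supremum controls its set only if the set is bounded above.\<close>
  have bdd: "bdd_above ((\<lambda>z. norm ((\<phi> ^^ j) z - a)) ` ball 0 1)" for j
  proof (rule bdd_aboveI2)
    fix z :: "complex ^ 'n" assume "z \<in> ball 0 1"
    then have "norm ((\<phi> ^^ j) z) < 1" using iterate_in_ball[of z j] by simp
    then show "norm ((\<phi> ^^ j) z - a) \<le> 1 + norm a" using norm_triangle_ineq4[of "(\<phi> ^^ j) z" a] by linarith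
  qed
  have nonneg: "0 \<le> ?s j" for j
    by (rule cSUP_upper2[OF bdd[of j], of 0]) auto
  have le: "?s j \<le> e \<longleftrightarrow> (\<forall>z\<in>ball 0 1. norm ((\<phi> ^^ j) z - a) \<le> e)" for j e
    by (rule cSUP_le_iff[OF _ bdd]) simp
  have "?s \<longlonglongrightarrow> 0 \<longleftrightarrow> (\<forall>e>0. \<exists>J. \<forall>j\<ge>J. ?s j \<le> e)"
  proof
    assume "?s \<longlonglongrightarrow> 0"
    then show "\<forall>e>0. \<exists>J. \<forall>j\<ge>J. ?s j \<le> e"
      unfolding LIMSEQ_iff by (force intro: less_imp_le)
  next
    assume *: "\<forall>e>0. \<exists>J. \<forall>j\<ge>J. ?s j \<le> e"
    show "?s \<longlonglongrightarrow> 0"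
    proof (rule LIMSEQ_I)
      fix e :: real assume "0 < e"
      then obtain J where "\<forall>j\<ge>J. ?s j \<le> e / 2" using *[rule_format, of "e / 2"] by auto
      then have "\<forall>j\<ge>J. norm (?s j - 0) < e" using nonneg \<open>0 < e\<close> by fastforce
      then show "\<exists>J. \<forall>j\<ge>J. norm (?s j - 0) < e" by blast
    qed
  qed
  then show ?thesis unfolding le uniform_attraction_def .
qed

text \<open>If one iterate sent the ball into a smaller closed ball, attraction on that compact ball
  would spread to the whole ball. Hence \<open>\<phi> ^^ k\<close> takes values arbitrarily near the
  sphere, and a value near enough forces all earlier points of the orbit near it as well.\<close>

lemma orbits_near_sphere:
  assumes "\<not> uniform_attraction" and \<eta>: "0 < \<eta>"
  shows "\<exists>z\<in>ball 0 1. \<forall>i\<le>k. 1 - norm ((\<phi> ^^ i) z) < \<eta>"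
proof -
  have escape: "\<exists>z\<in>ball 0 1. r < norm ((\<phi> ^^ j) z)" if r: "r < 1" for r j
  proof (rule ccontr)
    assume "\<not> ?thesis"
    then have r': "\<And>z. z \<in> ball 0 1 \<Longrightarrow> (\<phi> ^^ j) z \<in> cball 0 r" by (auto simp: not_less)
    have "uniform_attraction"
      unfolding uniform_attraction_def
    proof (intro allI impI)
      fix e :: real assume "0 < e"
      then obtain J where J: "\<And>i z. i \<ge> J \<Longrightarrow> z \<in> cball 0 r \<Longrightarrow> norm ((\<phi> ^^ i) z - a) < e"
        using uniform_attraction_on_compact[of "cball 0 r"] r by (metis cball_subset_ball_iff compact_cball dist_self add_0)
      have "norm ((\<phi> ^^ i) z - a) \<le> e" if "i \<ge> J + j" "z \<in> ball 0 1" for i z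
      proof -
        have "norm ((\<phi> ^^ (i - j)) ((\<phi> ^^ j) z) - a) < e" using J r' that by simp
        moreover have "(\<phi> ^^ (i - j)) ((\<phi> ^^ j) z) = (\<phi> ^^ i) z"
          using that by (simp flip: funpow_add o_apply[of "\<phi> ^^ (i - j)"])
        ultimately show ?thesis by simp
      qed
      then show "\<exists>J. \<forall>j\<ge>J. \<forall>z\<in>ball 0 1. norm ((\<phi> ^^ j) z - a) \<le> e" by blast
    qed
    with assms show False by simp
  qed
  have sub: "cball 0 (1 - \<eta>) \<subseteq> (ball 0 1 :: (complex ^ 'n) set)" using \<eta> by auto
  \<comment> \<open>An orbit that is still \<open>\<eta>\<close> away from the sphere at some time i
    up to k has its k-th point in this compact set.\<close>
  define K where "K = (\<Union>s\<le>k. (\<phi> ^^ s) ` cball 0 (1 - \<eta>))"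
  have "compact K"
    unfolding K_def
    by (intro compact_UN compact_continuous_image continuous_on_subset[OF continuous_on_iterate sub]) auto
  moreover have "K \<subseteq> ball 0 1" unfolding K_def using iterate_in_ball sub by blast
  ultimately obtain r where r: "r < 1" "K \<subseteq> cball 0 r" using compact_subset_unit_ball by metis
  obtain z where z: "z \<in> ball 0 1" "r < norm ((\<phi> ^^ k) z)" using escape[OF r(1)] by blast
  have "1 - norm ((\<phi> ^^ i) z) < \<eta>" if i: "i \<le> k" for i
  proof (rule ccontr)
    assume "\<not> ?thesis"
    then have "(\<phi> ^^ (k - i)) ((\<phi> ^^ i) z) \<in> K" unfolding K_def by force
    moreover have "(\<phi> ^^ (k - i)) ((\<phi> ^^ i) z) = (\<phi> ^^ k) z"
      using i by (simp flip: funpow_add o_apply[of "\<phi> ^^ (k - i)"])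
    ultimately show False using r z by auto
  qed
  with z show ?thesis by blast
qed

end

section \<open>Ergodicity and quasi-compactness\<close>

lemma cesaro_tendsto_zero:
  fixes c :: "nat \<Rightarrow> 'a::real_normed_vector"
  assumes c: "c \<longlonglongrightarrow> 0"
  shows "(\<lambda>j. (1 / real j) *\<^sub>R (\<Sum>i=1..j. c i)) \<longlonglongrightarrow> 0"
proof (rule LIMSEQ_I)
  fix e :: real assume e: "0 < e"
  obtain M where M: "\<And>i. i \<ge> M \<Longrightarrow> norm (c i) < e / 2"
    using LIMSEQ_D[OF c, of "e / 2"] e by auto
  define s where "s = (\<Sum>i<M. norm (c i))"
  have "(\<lambda>j. s * (1 / real j)) \<longlonglongrightarrow> s * 0"
    by (intro tendsto_intros lim_1_over_n)
  then have "\<forall>\<^sub>F j in sequentially. s * (1 / real j) < e / 2"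
    using e by (intro order_tendstoD(2)) auto
  then obtain L where L: "\<And>j. j \<ge> L \<Longrightarrow> s * (1 / real j) < e / 2"
    unfolding eventually_sequentially by blast
  have "norm ((1 / real j) *\<^sub>R (\<Sum>i=1..j. c i)) < e" if j: "j \<ge> max L 1" for j
  proof -
    have "norm (\<Sum>i=1..j. c i) \<le> (\<Sum>i=1..j. norm (c i))" by (rule norm_sum)
    also have "\<dots> \<le> (\<Sum>i=1..j. (if i < M then norm (c i) else 0) + e / 2)"
      using M e by (intro sum_mono) (auto simp: not_less less_imp_le)
    also have "\<dots> = (\<Sum>i\<in>{1..j} \<inter> {..<M}. norm (c i)) + real j * (e / 2)"
      by (simp add: sum.distrib sum.inter_restrict)
    also have "\<dots> \<le> s + real j * (e / 2)"
      unfolding s_def by (intro add_right_mono sum_mono2) auto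
    finally have "norm ((1 / real j) *\<^sub>R (\<Sum>i=1..j. c i)) \<le> (1 / real j) * (s + real j * (e / 2))"
      using j by (simp add: divide_right_mono)
    also have "\<dots> = s * (1 / real j) + e / 2" using j by (simp add: field_simps)
    also have "\<dots> < e" using L[of j] j by linarith
    finally show ?thesis .
  qed
  then show "\<exists>J. \<forall>j\<ge>J. norm ((1 / real j) *\<^sub>R (\<Sum>i=1..j. c i) - 0) < e"
    unfolding diff_zero by blast
qed

section \<open>Consequences of norm convergence of the powers\<close>

lemma bounded_clinear_funpow:
  fixes T :: "'a::complex_normed_vector \<Rightarrow> 'a"
  assumes T: "bounded_clinear T"
  shows "bounded_clinear (T ^^ j)"
proof (induction j)
  case 0
  have "T ^^ 0 = (\<lambda>x. x)" by (simp add: fun_eq_iff)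
  then show ?case by (simp only: bounded_clinear_def bounded_linear_ident simp_thms)
next
  case (Suc j)
  then show ?case using bounded_clinear_compose[OF T, of "T ^^ j"] by (simp add: o_def)
qed

lemma bounded_linear_cesaro_mean:
  assumes "bounded_clinear T"
  shows "bounded_linear (cesaro_mean j T)"
proof -
  have "bounded_linear (T ^^ i)" for i
    using bounded_clinear_funpow[OF assms] by (simp add: bounded_clinear_def)
  then show ?thesis
    unfolding cesaro_mean_def[abs_def]
    by (intro bounded_linear_compose[OF bounded_linear_scaleR_right] bounded_linear_sum)
qed

lemma uniformly_mean_ergodic_imp_mean_ergodic:
  assumes T: "bounded_clinear T" and "uniformly_mean_ergodic T"
  shows "mean_ergodic T"
proof -
  obtain P where P: "bounded_clinear P" "(\<lambda>j. onorm (\<lambda>x. cesaro_mean j T x - P x)) \<longlonglongrightarrow> 0"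
    using assms(2) unfolding uniformly_mean_ergodic_def by blast
  have "(\<lambda>j. cesaro_mean j T x) \<longlonglongrightarrow> P x" for x
  proof (rule Lim_transform_bound[THEN LIM_zero_cancel])
    show "\<forall>\<^sub>F j in sequentially. norm (cesaro_mean j T x - P x)
        \<le> norm (onorm (\<lambda>x. cesaro_mean j T x - P x) * norm x)"
    proof (intro always_eventually allI)
      fix j
      have "bounded_linear (\<lambda>x. cesaro_mean j T x - P x)"
        using P(1) bounded_linear_cesaro_mean[OF T]
        by (intro bounded_linear_sub) (auto simp: bounded_clinear_def)
      from onorm[OF this, of x]
      show "norm (cesaro_mean j T x - P x) \<le> norm (onorm (\<lambda>x. cesaro_mean j T x - P x) * norm x)"
        by simp
    qed
    show "(\<lambda>j. onorm (\<lambda>x. cesaro_mean j T x - P x) * norm x) \<longlonglongrightarrow> 0"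
      using P(2) by (rule tendsto_mult_left_zero)
  qed
  with P(1) show ?thesis unfolding mean_ergodic_def by blast
qed

text \<open>The distance of the mean from P is at most the Cesaro mean of the scalar sequence
  \<open>onorm (\<lambda>x. (T ^^ i) x - P x)\<close>, which tends to 0.\<close>

lemma norm_convergence_imp_uniformly_mean_ergodic:
  fixes T :: "'a::complex_normed_vector \<Rightarrow> 'a"
  assumes T: "bounded_clinear T" and P: "bounded_clinear P"
    and conv: "\<And>e. 0 < e \<Longrightarrow> \<exists>J. \<forall>j\<ge>J. \<forall>x. norm ((T ^^ j) x - P x) \<le> e * norm x"
  shows "uniformly_mean_ergodic T"
proof -
  let ?c = "\<lambda>i. onorm (\<lambda>x. (T ^^ i) x - P x)"
  have bl: "bounded_linear (\<lambda>x. (T ^^ i) x - P x)" for i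
    using P bounded_clinear_funpow[OF T] by (intro bounded_linear_sub) (auto simp: bounded_clinear_def)
  have "?c \<longlonglongrightarrow> 0"
  proof (rule LIMSEQ_I)
    fix e :: real assume e: "0 < e"
    then obtain J where J: "\<And>j x. j \<ge> J \<Longrightarrow> norm ((T ^^ j) x - P x) \<le> e / 2 * norm x"
      using conv[of "e / 2"] by auto
    have "norm (?c j - 0) < e" if "j \<ge> J" for j
    proof -
      have "?c j \<le> e / 2" using e J[OF that] by (intro onorm_bound) auto
      then show ?thesis using onorm_pos_le[OF bl[of j]] e by simp
    qed
    then show "\<exists>J. \<forall>j\<ge>J. norm (?c j - 0) < e" by blast
  qed
  from cesaro_tendsto_zero[OF this]
  have lim: "(\<lambda>j. (1 / real j) *\<^sub>R (\<Sum>i=1..j. ?c i)) \<longlonglongrightarrow> 0" .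
  have "(\<lambda>j. onorm (\<lambda>x. cesaro_mean j T x - P x)) \<longlonglongrightarrow> 0"
  proof (rule Lim_transform_bound[OF _ lim])
    have "norm (onorm (\<lambda>x. cesaro_mean j T x - P x)) \<le> norm ((1 / real j) *\<^sub>R (\<Sum>i=1..j. ?c i))"
      if j: "j \<ge> 1" for j
    proof -
      have bl': "bounded_linear (\<lambda>x. cesaro_mean j T x - P x)"
        using P bounded_linear_cesaro_mean[OF T]
        by (intro bounded_linear_sub) (auto simp: bounded_clinear_def)
      have c_nonneg: "0 \<le> ?c i" for i by (rule onorm_pos_le[OF bl])
      have "onorm (\<lambda>x. cesaro_mean j T x - P x) \<le> (1 / real j) * (\<Sum>i=1..j. ?c i)"
      proof (rule onorm_bound)
        fix x
        \<comment> \<open>For j at least 1 the vector \<open>P x\<close> is the average of j copies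
          of itself; for j = 0 the mean is 0 by the convention on division.\<close>
        have "cesaro_mean j T x - P x = (1 / real j) *\<^sub>R (\<Sum>i=1..j. (T ^^ i) x - P x)"
          using j by (simp add: cesaro_mean_def sum_subtractf scaleR_diff_right sum_constant_scaleR del: sum_constant)
        also have "norm \<dots> \<le> (1 / real j) * (\<Sum>i=1..j. ?c i * norm x)"
          by (auto intro!: mult_left_mono divide_right_mono sum_norm_le onorm[OF bl])
        finally show "norm (cesaro_mean j T x - P x) \<le> (1 / real j) * (\<Sum>i=1..j. ?c i) * norm x"
          by (simp add: sum_distrib_right)
      qed (use c_nonneg in \<open>auto intro!: divide_nonneg_nonneg sum_nonneg\<close>)
      then show ?thesis using onorm_pos_le[OF bl'] c_nonneg by (simp add: sum_nonneg)
    qed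
    then show "\<forall>\<^sub>F j in sequentially. norm (onorm (\<lambda>x. cesaro_mean j T x - P x))
        \<le> norm ((1 / real j) *\<^sub>R (\<Sum>i=1..j. ?c i))"
      unfolding eventually_sequentially by blast
  qed
  with P show ?thesis unfolding uniformly_mean_ergodic_def by blast
qed

text \<open>The limit P is itself a competitor in the infimum defining the essential norm.\<close>

lemma norm_convergence_to_compact_imp_quasi_compact:
  fixes T :: "'a::complex_normed_vector \<Rightarrow> 'a"
  assumes T: "bounded_clinear T" and P: "compact_operator P"
    and conv: "\<And>e. 0 < e \<Longrightarrow> \<exists>J. \<forall>j\<ge>J. \<forall>x. norm ((T ^^ j) x - P x) \<le> e * norm x"
  shows "quasi_compact T"
proof -
  obtain J where J: "\<And>j x. j \<ge> J \<Longrightarrow> norm ((T ^^ j) x - P x) \<le> 1/2 * norm x"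
    using conv[of "1/2"] by auto
  \<comment> \<open>The exponent has to be positive.\<close>
  let ?m = "max 1 J" and ?E = "{onorm (\<lambda>x. (T ^^ max 1 J) x - K x) | K :: 'a \<Rightarrow> 'a. compact_operator K}"
  have "0 \<le> b" if b: "b \<in> ?E" for b
  proof -
    obtain K :: "'a \<Rightarrow> 'a" where K: "compact_operator K" "b = onorm (\<lambda>x. (T ^^ ?m) x - K x)"
      using b by blast
    have "bounded_linear (\<lambda>x. (T ^^ ?m) x - K x)"
      using K(1) bounded_clinear_funpow[OF T]
      by (intro bounded_linear_sub) (auto simp: bounded_clinear_def compact_operator_def)
    then show ?thesis unfolding K(2) by (rule onorm_pos_le)
  qed
  then have "bdd_below ?E" by (rule bdd_belowI)
  moreover have "onorm (\<lambda>x. (T ^^ ?m) x - P x) \<in> ?E" using P by blast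
  ultimately have "essential_norm (T ^^ ?m) \<le> onorm (\<lambda>x. (T ^^ ?m) x - P x)"
    unfolding essential_norm_def by (intro cInf_lower)
  also have "\<dots> \<le> 1/2" by (intro onorm_bound J) auto
  finally show ?thesis unfolding quasi_compact_def by (intro exI[of _ ?m]) auto
qed

text \<open>Each further power of \<open>S\<close> shrinks the diameter reachable along a subsequence by the
  factor \<open>q\<close>, since the compact part contributes arbitrarily little after passing to a subsequence.\<close>

lemma near_compact_power_subsequence:
  fixes S :: "'a::complex_normed_vector \<Rightarrow> 'a"
  assumes S: "bounded_clinear S" "\<And>x. norm (S x) \<le> norm x" and K: "compact_operator K"
    and near: "\<And>x. norm (S x - K x) \<le> r * norm x" and q: "0 \<le> r" "r < q"
    and x: "\<And>l. norm (x l) \<le> 1"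
  shows "\<exists>s::nat \<Rightarrow> nat. strict_mono s \<and> (\<forall>l l'. norm ((S ^^ k) (x (s l)) - (S ^^ k) (x (s l'))) \<le> 2 * q ^ k)"
proof (induction k)
  case 0
  have "norm (x l - x l') \<le> 2" for l l'
    using x[of l] x[of l'] norm_triangle_ineq4[of "x l" "x l'"] by linarith
  then show ?case by (intro exI[of _ id]) (auto simp: strict_mono_def)
next
  case (Suc k)
  then obtain s :: "nat \<Rightarrow> nat" where s: "strict_mono s"
    "\<And>l l'. norm ((S ^^ k) (x (s l)) - (S ^^ k) (x (s l'))) \<le> 2 * q ^ k" by blast
  define y where "y l = (S ^^ k) (x (s l))" for l
  have "norm ((S ^^ i) v) \<le> norm v" for i v
  proof (induction i)
    case (Suc i)
    then show ?case using S(2)[of "(S ^^ i) v"] by simp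
  qed simp
  then have "norm (y l) \<le> 1" for l unfolding y_def using x order_trans by blast
  then have "K (y l) \<in> closure (K ` cball 0 1)" for l
    by (intro closure_subset[THEN subsetD] imageI) simp
  moreover have "seq_compact (closure (K ` cball 0 1))"
    using K unfolding compact_operator_def by (blast intro: compact_imp_seq_compact)
  ultimately obtain u t where t: "strict_mono t" "(\<lambda>l. K (y (t l))) \<longlonglongrightarrow> u"
    using seq_compactE[of "closure (K ` cball 0 1)" "\<lambda>l. K (y l)"] unfolding o_def by blast
  \<comment> \<open>The gap between r and q pays for the compact part:
    \<open>2 * ((q - r) * q ^ k) + r * (2 * q ^ k) = 2 * q ^ Suc k\<close>.\<close>
  have "0 < (q - r) * q ^ k" using q by simp
  from LIMSEQ_D[OF t(2) this]
  obtain N where N: "\<And>l. l \<ge> N \<Longrightarrow> norm (K (y (t l)) - u) < (q - r) * q ^ k" by blast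
  define s' where "s' l = s (t (l + N))" for l
  have lin: "linear S" "linear K"
    using S(1) K by (auto simp: bounded_clinear_def compact_operator_def bounded_linear.linear)
  have "norm ((S ^^ Suc k) (x (s' l)) - (S ^^ Suc k) (x (s' l'))) \<le> 2 * q ^ Suc k" for l l'
  proof -
    let ?y = "y (t (l + N))" and ?y' = "y (t (l' + N))"
    have K2: "norm (K ?y - K ?y') \<le> 2 * ((q - r) * q ^ k)"
      using N[of "l + N"] N[of "l' + N"] norm_triangle_ineq4[of "K ?y - u" "K ?y' - u"] by simp
    have "(S ^^ Suc k) (x (s' l)) - (S ^^ Suc k) (x (s' l')) = S ?y - S ?y'"
      by (simp add: s'_def y_def)
    also have "\<dots> = (K ?y - K ?y') + (S (?y - ?y') - K (?y - ?y'))"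
      by (simp add: linear_diff[OF lin(1)] linear_diff[OF lin(2)])
    also have "norm \<dots> \<le> 2 * ((q - r) * q ^ k) + r * (2 * q ^ k)"
      using K2 near[of "?y - ?y'"] mult_left_mono[OF s(2)[of "t (l + N)" "t (l' + N)"] q(1)]
      by (intro norm_triangle_le) (simp add: y_def)
    also have "\<dots> = 2 * q ^ Suc k" by (simp add: algebra_simps)
    finally show ?thesis .
  qed
  moreover have "strict_mono s'"
    using s(1) t(1) by (auto simp: s'_def strict_mono_def)
  ultimately show ?case by blast
qed

section \<open>Powers of the composition operator\<close>

lemma Hinf_of_bounded_holomorphic:
  assumes f: "holomorphic_map_on f (ball 0 1)" and b: "\<And>z. z \<in> ball 0 1 \<Longrightarrow> cmod (f z) \<le> b"
  obtains F where "\<And>z. z \<in> ball 0 1 \<Longrightarrow> Hinf_fun F z = f z"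
proof -
  let ?g = "\<lambda>z. if z \<in> ball 0 1 then f z else 0"
  have "?g \<in> Hinf_set"
  proof (rule Hinf_setI[where b = b])
    fix z :: "complex ^ 'a" assume z: "z \<in> ball 0 1"
    then obtain D where D: "bounded_clinear D" "(f has_derivative D) (at z)"
      using f unfolding holomorphic_map_on_def by blast
    have "(?g has_derivative D) (at z)"
      by (rule has_derivative_transform_within_open[OF D(2) open_ball z]) simp
    with D(1) show "\<exists>D. bounded_clinear D \<and> (?g has_derivative D) (at z)" by blast
  qed (use b in auto)
  then show ?thesis by (intro that[of "Abs_Hinf ?g"]) (simp add: Abs_Hinf_inverse)
qed

lemma holomorphic_map_on_const: "open S \<Longrightarrow> holomorphic_map_on (\<lambda>_. c) S"
  unfolding holomorphic_map_on_def using bounded_clinear_zero has_derivative_const by blast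

context ball_self_map
begin

lemmas bounded_clinear_C = bounded_clinear_comp_op[OF hol self]

lemma norm_comp_op_funpow_le: "norm ((comp_op \<phi> ^^ j) f) \<le> norm f"
  by (rule Hinf_norm_least) (simp add: comp_op_funpow Hinf_norm_le)

end

context attracting_self_map
begin

text \<open>The expected limit operator, evaluation at a followed by the embedding of constants, is
  written as composition with a constant map, so the facts on composition operators apply to
  it.\<close>

lemma comp_op_const: "z \<in> ball 0 1 \<Longrightarrow> Hinf_fun (comp_op (\<lambda>_. a) f) z = Hinf_fun f a"
  using a by (intro comp_op_fun holomorphic_map_on_const) auto

text \<open>The operator has rank one: it sends the unit ball into the multiples of the constant
  function 1 by scalars from the closed disc, a compact set.\<close>

lemma compact_operator_comp_op_const: "compact_operator (comp_op (\<lambda>_. a))"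
  unfolding compact_operator_def
proof
  show "bounded_clinear (comp_op (\<lambda>_. a))"
    using a by (intro bounded_clinear_comp_op holomorphic_map_on_const) auto
  obtain e :: "'n Hinf" where e: "\<And>z. z \<in> ball 0 1 \<Longrightarrow> Hinf_fun e z = 1"
    using Hinf_of_bounded_holomorphic[OF holomorphic_map_on_const[OF open_ball], of 1 1] by auto
  let ?K = "(\<lambda>c. c *\<^sub>C e) ` cball 0 1"
  have "compact ?K"
    by (intro compact_continuous_image linear_continuous_on bounded_linear_scaleC_left) simp
  have "comp_op (\<lambda>_. a) f = Hinf_fun f a *\<^sub>C e" for f
  proof (rule Hinf_eqI)
    fix z
    show "Hinf_fun (comp_op (\<lambda>_. a) f) z = Hinf_fun (Hinf_fun f a *\<^sub>C e) z"
      by (cases "z \<in> ball 0 1")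
        (use comp_op_const e in \<open>auto simp: scaleC_Hinf.rep_eq Hinf_set_outside[OF Hinf_fun]\<close>)
  qed
  then have "comp_op (\<lambda>_. a) ` cball 0 1 \<subseteq> ?K"
    using Hinf_norm_le order_trans by fastforce
  then have "closure (comp_op (\<lambda>_. a) ` cball 0 1) \<subseteq> ?K"
    using compact_imp_closed[OF \<open>compact ?K\<close>] by (rule closure_minimal)
  then show "compact (closure (comp_op (\<lambda>_. a) ` cball 0 1))"
    using compact_Int_closed[OF \<open>compact ?K\<close> closed_closure] by (metis inf.absorb2)
qed

text \<open>The Schwarz lemma at a bounds the change of f between a and a nearby point by a multiple
  of \<open>norm f\<close> times the distance, with a factor independent of f.\<close>

lemma uniform_attraction_imp_norm_convergence:
  assumes "uniform_attraction" and e: "0 < e"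
  shows "\<exists>J. \<forall>j\<ge>J. \<forall>f. norm ((comp_op \<phi> ^^ j) f - comp_op (\<lambda>_. a) f) \<le> e * norm f"
proof -
  define d where "d = 1 - norm a"
  have d: "0 < d" using a by (simp add: d_def)
  have sub: "ball a d \<subseteq> ball 0 1" unfolding d_def by (rule ball_subset_unit_ball)
  \<comment> \<open>The first entry keeps the iterates in \<open>ball a d\<close>; the second
    cancels the Lipschitz constant \<open>3 * norm f / d\<close>.\<close>
  have "0 < min (d / 2) (e * d / 3)" using d e by simp
  then obtain J where J: "\<And>j z. j \<ge> J \<Longrightarrow> z \<in> ball 0 1 \<Longrightarrow> norm ((\<phi> ^^ j) z - a) \<le> min (d / 2) (e * d / 3)"
    using assms(1) unfolding uniform_attraction_def by meson
  have "norm ((comp_op \<phi> ^^ j) f - comp_op (\<lambda>_. a) f) \<le> e * norm f" if j: "j \<ge> J" for j f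
  proof (rule Hinf_norm_least)
    fix z :: "complex ^ 'n" assume z: "z \<in> ball 0 1"
    let ?w = "(\<phi> ^^ j) z"
    have w: "norm (?w - a) \<le> d / 2" "norm (?w - a) \<le> e * d / 3" using J[OF j z] by auto
    have "cmod (Hinf_fun f ?w - Hinf_fun f a) \<le> e * norm f"
    \<comment> \<open>The strict bound \<open>3 * norm f\<close> required by the Schwarz lemma fails
      for f = 0.\<close>
    proof (cases "f = 0")
      case False
      have "cmod (Hinf_fun f ?w - Hinf_fun f a) \<le> 3 * norm f / d * norm (?w - a)"
      proof (rule schwarz_lipschitz[OF _ sub d])
        show "holomorphic_map_on (Hinf_fun f) (ball 0 1)" using Hinf_fun[of f] by (simp add: Hinf_set_def)
        show "?w \<in> ball a d" using w(1) d by (simp add: dist_norm norm_minus_commute)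
        have "0 < norm f" using False by simp
        then show "cmod (Hinf_fun f y - Hinf_fun f a) < 3 * norm f" for y
          using norm_triangle_ineq4[of "Hinf_fun f y" "Hinf_fun f a"]
            Hinf_norm_le[of f y] Hinf_norm_le[of f a] by linarith
      qed
      also have "\<dots> \<le> 3 * norm f / d * (e * d / 3)"
        using w(2) d by (intro mult_left_mono) auto
      also have "\<dots> = e * norm f" using d by simp
      finally show ?thesis .
    qed (simp add: zero_Hinf.rep_eq)
    then show "cmod (Hinf_fun ((comp_op \<phi> ^^ j) f - comp_op (\<lambda>_. a) f) z) \<le> e * norm f"
      using z by (simp add: minus_Hinf.rep_eq comp_op_funpow comp_op_const)
  qed
  then show ?thesis by blast
qed

lemma coordinate_Hinf:
  obtains e :: "'n Hinf" where "\<And>z. z \<in> ball 0 1 \<Longrightarrow> Hinf_fun e z = z $ i" "norm e \<le> 1"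
proof -
  have le: "cmod (z $ i) \<le> 1" if "z \<in> ball 0 1" for z :: "complex ^ 'n"
    using that Finite_Cartesian_Product.norm_nth_le[of z i] by simp
  have "holomorphic_map_on (\<lambda>z. z $ i) (ball 0 1 :: (complex ^ 'n) set)"
    using holomorphic_component[OF holomorphic_iterate[of 0]] by simp
  then obtain e :: "'n Hinf" where "\<And>z. z \<in> ball 0 1 \<Longrightarrow> Hinf_fun e z = z $ i"
    using Hinf_of_bounded_holomorphic le by blast
  then show ?thesis by (intro that[of e] Hinf_norm_least) (auto simp: le)
qed

text \<open>Suppose a coordinate stays more than e away from its value at a along times tending to
  infinity. Near-compactness makes the composed coordinate functions pairwise closer than e in norm
  along a subsequence. Evaluating at one fixed point and letting the second time tend to infinity
  contradicts pointwise attraction.\<close>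

lemma quasi_compact_imp_uniform_attraction:
  assumes "quasi_compact (comp_op \<phi>)"
  shows uniform_attraction
proof -
  obtain m where m: "m \<ge> 1" "essential_norm (comp_op \<phi> ^^ m) < 1"
    using assms unfolding quasi_compact_def by blast
  define S where "S = comp_op \<phi> ^^ m"
  have S: "bounded_clinear S" "\<And>x. norm (S x) \<le> norm x"
    unfolding S_def using bounded_clinear_funpow[OF bounded_clinear_C] norm_comp_op_funpow_le by auto
  \<comment> \<open>An infimum below 1 provides a witness only over a nonempty set.\<close>
  have "{onorm (\<lambda>x. S x - K x) | K. compact_operator K} \<noteq> {}"
    using compact_operator_comp_op_const by blast
  from cInf_lessD[OF this, of 1] m(2)
  obtain K where K: "compact_operator K" "onorm (\<lambda>x. S x - K x) < 1"
    unfolding essential_norm_def S_def[symmetric] by blast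
  define r where "r = onorm (\<lambda>x. S x - K x)"
  have bl: "bounded_linear (\<lambda>x. S x - K x)"
    using S(1) K(1) by (intro bounded_linear_sub) (auto simp: bounded_clinear_def compact_operator_def)
  have near: "norm (S x - K x) \<le> r * norm x" for x
    unfolding r_def by (rule onorm[OF bl])
  have r: "0 \<le> r" "r < 1" using onorm_pos_le[OF bl] K(2) by (auto simp: r_def)
  obtain q where q: "r < q" "q < 1" using dense[OF r(2)] by blast
  have component: "\<exists>J. \<forall>j\<ge>J. \<forall>z\<in>ball 0 1. cmod ((\<phi> ^^ j) z $ i - a $ i) \<le> e" if e: "0 < e" for e i
  proof (rule ccontr)
    assume neg: "\<not> ?thesis"
    obtain c :: "'n Hinf" where c: "\<And>z. z \<in> ball 0 1 \<Longrightarrow> Hinf_fun c z = z $ i" "norm c \<le> 1"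
      using coordinate_Hinf by blast
    have "(\<lambda>k. 2 * q ^ k) \<longlonglongrightarrow> 2 * 0"
      using r q by (intro tendsto_intros LIMSEQ_realpow_zero) auto
    then have "\<forall>\<^sub>F k in sequentially. 2 * q ^ k < e"
      using e by (intro order_tendstoD(2)) auto
    then obtain k where k: "2 * q ^ k < e" by (auto simp: eventually_sequentially)
    \<comment> \<open>The summand \<open>m * k\<close> reserves room for splitting off
      \<open>S ^^ k\<close>; the summand l drives the times to infinity.\<close>
    have "\<forall>l. \<exists>j z. j \<ge> m * k + l \<and> z \<in> ball 0 1 \<and> e < cmod ((\<phi> ^^ j) z $ i - a $ i)"
      using neg by (meson not_le)
    then obtain j z where j: "\<And>l. j l \<ge> m * k + l" "\<And>l. z l \<in> ball 0 1"
        "\<And>l. e < cmod ((\<phi> ^^ j l) (z l) $ i - a $ i)" by metis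
    define x where "x l = (comp_op \<phi> ^^ (j l - m * k)) c" for l
    have "norm (x l) \<le> 1" for l unfolding x_def using norm_comp_op_funpow_le c(2) order_trans by blast
    from near_compact_power_subsequence[where x = x, OF S K(1) near r(1) q(1) this, of k]
    obtain s :: "nat \<Rightarrow> nat" where s: "strict_mono s"
      "\<And>l l'. norm ((S ^^ k) (x (s l)) - (S ^^ k) (x (s l'))) \<le> 2 * q ^ k" by blast
    have Sx: "(S ^^ k) (x l) = (comp_op \<phi> ^^ j l) c" for l
    proof -
      have "(S ^^ k) (x l) = (comp_op \<phi> ^^ (m * k + (j l - m * k))) c"
        unfolding S_def x_def funpow_mult by (simp add: funpow_add)
      then show ?thesis using j(1)[of l] by simp
    qed
    \<comment> \<open>The point stays frozen at the first index while only the iterate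
      varies.\<close>
    let ?z = "z (s 0)" and ?p = "\<lambda>l. (\<phi> ^^ j (s l)) (z (s 0)) $ i"
    have close: "cmod (?p 0 - ?p l) \<le> 2 * q ^ k" for l
    proof -
      have "cmod (Hinf_fun ((S ^^ k) (x (s 0)) - (S ^^ k) (x (s l))) ?z) \<le> 2 * q ^ k"
        using s(2) Hinf_norm_le order_trans by blast
      then show ?thesis
        using j(2) iterate_in_ball[OF j(2)] by (simp add: Sx minus_Hinf.rep_eq comp_op_funpow c(1))
    qed
    have "l \<le> j (s l)" for l
      using seq_suble[OF s(1), of l] j(1)[of "s l"] by simp
    then have "filterlim (\<lambda>l. j (s l)) sequentially sequentially"
      by (intro filterlim_at_top_mono[OF filterlim_ident]) auto
    from filterlim_compose[OF pointwise_attraction[OF j(2)] this]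
    have "?p \<longlonglongrightarrow> a $ i" by (rule tendsto_vec_nth)
    then have "(\<lambda>l. cmod (?p 0 - ?p l)) \<longlonglongrightarrow> cmod (?p 0 - a $ i)"
      by (intro tendsto_norm tendsto_diff tendsto_const)
    then have "cmod (?p 0 - a $ i) \<le> 2 * q ^ k"
      by (rule Lim_bounded[where M = 0]) (use close in blast)
    then show False using j(3)[of "s 0"] k by simp
  qed
  show ?thesis
    unfolding uniform_attraction_def
  proof (intro allI impI)
    fix e :: real assume "0 < e"
    then have "0 < e / CARD('n)" by simp
    then have "\<forall>i. \<exists>J. \<forall>j\<ge>J. \<forall>z\<in>ball 0 1. cmod ((\<phi> ^^ j) z $ i - a $ i) \<le> e / CARD('n)"
      using component by blast
    then obtain J where J: "\<And>i j z. j \<ge> J i \<Longrightarrow> z \<in> ball 0 1 \<Longrightarrow>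
        cmod ((\<phi> ^^ j) z $ i - a $ i) \<le> e / CARD('n)" by metis
    have "norm ((\<phi> ^^ j) z - a) \<le> e" if j: "j \<ge> Max (range J)" and z: "z \<in> ball 0 1" for j z
    proof -
      have "norm ((\<phi> ^^ j) z - a) \<le> (\<Sum>i\<in>UNIV. norm (((\<phi> ^^ j) z - a) $ i))"
        unfolding norm_vec_def by (intro L2_set_le_sum) simp
      also have "\<dots> \<le> (\<Sum>i\<in>(UNIV::'n set). e / CARD('n))"
      proof (rule sum_mono)
        fix i
        have "J i \<le> Max (range J)" by (intro Max_ge) auto
        then show "norm (((\<phi> ^^ j) z - a) $ i) \<le> e / CARD('n)" using J[of i j z] j z by simp
      qed
      also have "\<dots> = e" by simp
      finally show ?thesis .
    qed
    then show "\<exists>J. \<forall>j\<ge>J. \<forall>z\<in>ball 0 1. norm ((\<phi> ^^ j) z - a) \<le> e" by blast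
  qed
qed

end

section \<open>Blaschke products on the ball\<close>

text \<open>The Hermitian inner product, conjugated in the second slot so that it is holomorphic in
  the first.\<close>

definition cinner :: "complex ^ 'n \<Rightarrow> complex ^ 'n \<Rightarrow> complex"
  where "cinner w u = (\<Sum>i\<in>UNIV. w $ i * cnj (u $ i))"

lemma norm_cinner_le: "cmod (cinner w u) \<le> norm w * norm u" for w u :: "complex ^ 'n::finite"
proof -
  have "cmod (cinner w u) \<le> (\<Sum>i\<in>UNIV. \<bar>cmod (w $ i)\<bar> * \<bar>cmod (u $ i)\<bar>)"
    unfolding cinner_def by (rule sum_norm_le) (simp add: norm_mult)
  also have "\<dots> \<le> norm w * norm u"
    unfolding norm_vec_def by (rule L2_set_mult_ineq)
  finally show ?thesis .
qed

lemma cinner_self: "cinner u u = (complex_of_real (norm u))\<^sup>2" for u :: "complex ^ 'n::finite"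
proof -
  have "cinner u u = complex_of_real (\<Sum>i\<in>UNIV. (cmod (u $ i))\<^sup>2)"
    by (simp only: cinner_def of_real_sum complex_norm_square)
  also have "(\<Sum>i\<in>UNIV. (cmod (u $ i))\<^sup>2) = (norm u)\<^sup>2"
    by (simp add: norm_vec_def L2_set_def sum_nonneg)
  finally show ?thesis by simp
qed

lemma bounded_clinear_cinner: "bounded_clinear (\<lambda>w::complex ^ 'n::finite. cinner w u)"
  unfolding bounded_clinear_def
proof
  show "bounded_linear (\<lambda>w. cinner w u)"
    using norm_cinner_le
    by (intro bounded_linear_intro[where K = "norm u"])
      (auto simp: cinner_def distrib_right sum.distrib sum_distrib_left scaleR_sum_right)
qed (simp add: cinner_def scaleC_vec_def scaleC_complex_def sum_distrib_left mult.assoc)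

lemma holomorphic_map_on_compose_clinear:
  fixes l :: "'a::complex_normed_vector \<Rightarrow> complex"
  assumes h: "h holomorphic_on T" "open T" and l: "bounded_clinear l"
    and S: "open S" "l ` S \<subseteq> T"
  shows "holomorphic_map_on (\<lambda>z. h (l z)) S"
  unfolding holomorphic_map_on_def
proof (intro conjI ballI)
  fix z assume "z \<in> S"
  then have "l z \<in> T" using S by blast
  then have "(h has_derivative (*) (deriv h (l z))) (at (l z))"
    using holomorphic_derivI[OF h] by (simp add: has_field_derivative_def)
  moreover have "(l has_derivative l) (at z)"
    using l by (simp add: bounded_clinear_def bounded_linear_imp_has_derivative)
  ultimately have "((\<lambda>z. h (l z)) has_derivative (\<lambda>x. deriv h (l z) * l x)) (at z)"
    using has_derivative_compose by blast
  moreover have "bounded_clinear (\<lambda>x. deriv h (l z) * l x)"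
    using bounded_clinear_scaleC[OF l] by (simp add: scaleC_complex_def)
  ultimately show "\<exists>D. bounded_clinear D \<and> ((\<lambda>z. h (l z)) has_derivative D) (at z)" by blast
qed (rule S)

lemma holomorphic_map_on_mult:
  fixes f g :: "'a::complex_normed_vector \<Rightarrow> complex"
  assumes "holomorphic_map_on f S" "holomorphic_map_on g S"
  shows "holomorphic_map_on (\<lambda>z. f z * g z) S"
  unfolding holomorphic_map_on_def
proof (intro conjI ballI)
  fix z assume z: "z \<in> S"
  obtain D E where D: "bounded_clinear D" "(f has_derivative D) (at z)"
    and E: "bounded_clinear E" "(g has_derivative E) (at z)"
    using assms z unfolding holomorphic_map_on_def by blast
  have "bounded_clinear (\<lambda>x. f z * E x + D x * g z)"
    using bounded_clinear_add[OF bounded_clinear_scaleC[OF E(1), of "f z"] bounded_clinear_scaleC[OF D(1), of "g z"]]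
    by (simp add: scaleC_complex_def mult.commute)
  then show "\<exists>D. bounded_clinear D \<and> ((\<lambda>z. f z * g z) has_derivative D) (at z)"
    using has_derivative_mult[OF D(2) E(2)] by blast
qed (use assms in \<open>simp add: holomorphic_map_on_def\<close>)

lemma holomorphic_map_on_prod:
  fixes f :: "'i \<Rightarrow> 'a::complex_normed_vector \<Rightarrow> complex"
  assumes "open S" "\<And>i. i \<in> I \<Longrightarrow> holomorphic_map_on (f i) S"
  shows "holomorphic_map_on (\<lambda>z. \<Prod>i\<in>I. f i z) S"
  using assms(2)
  by (induction I rule: infinite_finite_induct)
    (simp_all add: holomorphic_map_on_const[OF assms(1)] holomorphic_map_on_mult)

text \<open>With \<open>t = \<bar>p\<bar>\<close> and \<open>\<zeta> = \<langle>w, p / t\<rangle>\<close> this is the one-variable Blaschke factor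
  \<open>(t - \<zeta>) / (1 - t \<zeta>)\<close>, normalised so that it tends to \<open>1\<close> as \<open>t \<rightarrow> 1\<close>.\<close>

definition ball_blaschke :: "complex ^ 'n \<Rightarrow> complex ^ 'n \<Rightarrow> complex"
  where "ball_blaschke p w = - Moebius_function 0 (norm p) (cinner w p / norm p)"

text \<open>By Cauchy-Schwarz the one-variable argument z = \<open>cinner w p / norm p\<close> has
  modulus at most \<open>norm w\<close>, so the disc facts apply. With t = \<open>norm p\<close>,
  the estimate near 1 comes from the identity 1 - b = (1 - t)(1 + z) / (1 - t z).\<close>

lemma ball_blaschke:
  fixes p w :: "complex ^ 'n::finite"
  assumes p: "p \<noteq> 0" "norm p < 1"
  shows holomorphic_ball_blaschke: "holomorphic_map_on (ball_blaschke p) (ball 0 1)"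
    and norm_ball_blaschke_le: "norm w < 1 \<Longrightarrow> cmod (ball_blaschke p w) \<le> 1"
    and ball_blaschke_near_one: "norm w < 1 \<Longrightarrow>
      cmod (1 - ball_blaschke p w) \<le> 2 * (1 - norm p) / (1 - norm w)"
    and ball_blaschke_self: "ball_blaschke p p = 0"
proof -
  let ?t = "complex_of_real (norm p)"
  have t: "cmod ?t < 1" "0 < norm p" using p by auto
  have \<zeta>_le: "cmod (cinner w p / ?t) \<le> norm w" for w
    using norm_cinner_le[of w p] t(2) by (simp add: norm_divide field_simps)
  have clin: "bounded_clinear (\<lambda>w. cinner w p / ?t)"
    using bounded_clinear_scaleC[OF bounded_clinear_cinner, of "1 / ?t" p]
    by (simp add: scaleC_complex_def)
  show "holomorphic_map_on (ball_blaschke p) (ball 0 1)"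
    unfolding ball_blaschke_def[abs_def]
  proof (rule holomorphic_map_on_compose_clinear[OF _ open_ball clin open_ball])
    show "(\<lambda>z. - Moebius_function 0 ?t z) holomorphic_on ball 0 1"
      by (intro holomorphic_intros Moebius_function_holomorphic t)
    show "(\<lambda>w. cinner w p / ?t) ` ball 0 1 \<subseteq> ball 0 1"
    proof clarify
      fix w :: "complex ^ 'n" assume "w \<in> ball 0 1"
      then show "cinner w p / ?t \<in> ball 0 1" using \<zeta>_le[of w] by (simp del: norm_divide)
    qed
  qed
  show "cmod (ball_blaschke p w) \<le> 1" if "norm w < 1"
    using Moebius_function_norm_lt_1[OF t(1), of "cinner w p / ?t" 0] \<zeta>_le[of w] that
    by (simp add: ball_blaschke_def)
  show "cmod (1 - ball_blaschke p w) \<le> 2 * (1 - norm p) / (1 - norm w)" if w: "norm w < 1"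
  proof -
    define \<zeta> where "\<zeta> = cinner w p / ?t"
    have \<zeta>: "cmod \<zeta> \<le> norm w" "cmod \<zeta> < 1" using \<zeta>_le[of w] w by (auto simp: \<zeta>_def)
    have "cmod (?t * \<zeta>) \<le> 1 * cmod \<zeta>"
      unfolding norm_mult using t by (intro mult_right_mono) auto
    then have den: "1 - norm w \<le> cmod (1 - ?t * \<zeta>)"
      using \<zeta>(1) norm_triangle_ineq2[of 1 "?t * \<zeta>"] by simp
    then have "1 - ?t * \<zeta> \<noteq> 0" using w by auto
    then have "1 - ball_blaschke p w = (1 - ?t) * (1 + \<zeta>) / (1 - ?t * \<zeta>)"
      unfolding ball_blaschke_def Moebius_function_simple \<zeta>_def[symmetric]
      by (simp add: field_simps)
    also have "cmod \<dots> = (1 - norm p) * cmod (1 + \<zeta>) / cmod (1 - ?t * \<zeta>)"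
    proof -
      have "cmod (1 - ?t) = 1 - norm p"
        using p by (metis abs_of_nonneg diff_ge_0_iff_ge less_imp_le norm_of_real of_real_1 of_real_diff)
      then show ?thesis by (simp add: norm_divide norm_mult)
    qed
    also have "\<dots> \<le> (1 - norm p) * 2 / (1 - norm w)"
      using p w den \<zeta>(2) norm_triangle_ineq[of 1 \<zeta>]
      by (intro frac_le mult_left_mono mult_nonneg_nonneg) auto
    finally show ?thesis by (simp add: mult.commute)
  qed
  show "ball_blaschke p p = 0"
    using t(2) by (simp add: ball_blaschke_def cinner_self power2_eq_square Moebius_function_eq_zero)
qed

text \<open>The partial products are bounded by 1, so their increments are dominated by
  \<open>c k / (1 - norm w)\<close> and the Weierstrass test gives locally uniform convergence. At a
  the limit differs from 1 by at most \<open>suminf c / (1 - norm a)\<close>, which is below 1, so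
  it does not vanish there.\<close>

lemma infinite_product_Hinf:
  fixes g :: "nat \<Rightarrow> complex ^ 'n::finite \<Rightarrow> complex"
  assumes hol: "\<And>k. holomorphic_map_on (g k) (ball 0 1)"
    and le1: "\<And>k w. norm w < 1 \<Longrightarrow> cmod (g k w) \<le> 1"
    and near1: "\<And>k w. norm w < 1 \<Longrightarrow> cmod (1 - g k w) \<le> c k / (1 - norm w)"
    and c: "summable c" and a: "norm a < 1" "suminf c < 1 - norm a"
  obtains F where "Hinf_fun F a \<noteq> 0" "\<And>k w. norm w < 1 \<Longrightarrow> g k w = 0 \<Longrightarrow> Hinf_fun F w = 0"
proof -
  define P where "P n w = (\<Prod>k<n. g k w)" for n w
  define s where "s n w = P (Suc n) w - P n w" for n w
  \<comment> \<open>The infinite product is written as a telescoping series.\<close>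
  define f where "f w = 1 + (\<Sum>n. s n w)" for w
  have P_le: "cmod (P n w) \<le> 1" if "norm w < 1" for n w
    unfolding P_def prod_norm[symmetric] using le1[OF that] by (intro prod_le_1) auto
  have s_le: "cmod (s n w) \<le> c n / (1 - norm w)" if w: "norm w < 1" for n w
  proof -
    have "s n w = - (P n w * (1 - g n w))" by (simp add: s_def P_def algebra_simps)
    then have "cmod (s n w) = cmod (P n w) * cmod (1 - g n w)" by (simp add: norm_mult)
    also have "\<dots> \<le> 1 * cmod (1 - g n w)" by (intro mult_right_mono P_le[OF w]) simp
    finally show ?thesis using near1[OF w, of n] by simp
  qed
  have P_sum: "P n w = 1 + (\<Sum>i<n. s i w)" for n w
  proof -
    have "(\<Sum>i<n. s i w) = P n w - P 0 w" unfolding s_def by (rule sum_lessThan_telescope)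
    moreover have "P 0 w = 1" by (simp add: P_def)
    ultimately show ?thesis by simp
  qed
  \<comment> \<open>At w = 0 the denominator is 1 and the bound dominates a norm.\<close>
  have c0: "0 \<le> c n" for n using order_trans[OF norm_ge_zero near1[of 0 n]] by simp
  \<comment> \<open>On a ball of half the distance to the sphere, \<open>1 - norm w\<close> stays
    above that half distance, which gives a majorant independent of w.\<close>
  have ul: "uniform_limit (ball x ((1 - norm x) / 2)) P f sequentially" if x: "norm x < 1" for x
  proof -
    have "cmod (s n w) \<le> c n / ((1 - norm x) / 2)" if w: "w \<in> ball x ((1 - norm x) / 2)" for n w
    proof -
      have *: "(1 - norm x) / 2 \<le> 1 - norm w"
        using w norm_triangle_sub[of w x] by (simp add: dist_norm norm_minus_commute field_simps)
      moreover have "0 < (1 - norm x) / 2" using x by simp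
      ultimately have "norm w < 1" by linarith
      from s_le[OF this, of n] have "cmod (s n w) \<le> c n / (1 - norm w)" .
      also have "\<dots> \<le> c n / ((1 - norm x) / 2)" using * x c0 by (intro divide_left_mono) auto
      finally show ?thesis .
    qed
    then have "uniform_limit (ball x ((1 - norm x) / 2)) (\<lambda>n w. \<Sum>i<n. s i w) (\<lambda>w. \<Sum>i. s i w) sequentially"
      using c by (intro Weierstrass_m_test[where M = "\<lambda>n. c n / ((1 - norm x) / 2)"] summable_divide)
    then have "uniform_limit (ball x ((1 - norm x) / 2)) (\<lambda>n w. 1 + (\<Sum>i<n. s i w)) (\<lambda>w. 1 + (\<Sum>i. s i w)) sequentially"
      by (intro uniform_limit_intros)
    moreover have "P = (\<lambda>n w. 1 + (\<Sum>i<n. s i w))" by (intro ext P_sum)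
    ultimately show ?thesis unfolding f_def[abs_def] by simp
  qed
  have lim: "(\<lambda>n. P n w) \<longlonglongrightarrow> f w" if "norm w < 1" for w
    using tendsto_uniform_limitI[OF ul[OF that]] that by simp
  have "holomorphic_map_on f (ball 0 1)"
  proof (rule holomorphic_map_on_uniform_limit)
    show "holomorphic_map_on (P n) (ball 0 1)" for n
      unfolding P_def[abs_def] using hol by (intro holomorphic_map_on_prod) auto
    fix x :: "complex ^ 'n" assume "x \<in> ball 0 1"
    then have x: "norm x < 1" by simp
    have "ball x ((1 - norm x) / 2) \<subseteq> ball x (1 - norm x)" using x by (intro subset_ball) simp
    then have "ball x ((1 - norm x) / 2) \<subseteq> ball 0 1" using ball_subset_unit_ball by blast
    then show "\<exists>d>0. ball x d \<subseteq> ball 0 1 \<and> uniform_limit (ball x d) P f sequentially"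
      using ul[OF x] x by (intro exI[of _ "(1 - norm x) / 2"]) auto
  qed simp
  moreover have "cmod (f w) \<le> 1" if "w \<in> ball 0 1" for w
    using that by (intro Lim_bounded[OF tendsto_norm[OF lim], of w 0]) (auto simp: P_le)
  ultimately obtain F where F: "\<And>w. w \<in> ball 0 1 \<Longrightarrow> Hinf_fun F w = f w"
    using Hinf_of_bounded_holomorphic by blast
  show thesis
  proof (rule that)
    have "cmod (f a - 1) \<le> (\<Sum>n. c n / (1 - norm a))"
      unfolding f_def add_diff_cancel_left' using s_le[OF a(1)] c
      by (intro norm_suminf_le summable_divide) auto
    also have "\<dots> = suminf c / (1 - norm a)" by (rule suminf_divide[OF c])
    also have "\<dots> < 1" using a by simp
    finally have "f a \<noteq> 0" by auto
    then show "Hinf_fun F a \<noteq> 0" using F a by simp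
  next
    fix k w assume w: "norm w < 1" "g k w = 0"
    have "P n w = 0" if "n \<ge> Suc k" for n
      unfolding P_def using that w(2) by (intro prod_zero) auto
    then have "\<forall>\<^sub>F n in sequentially. P n w = 0" unfolding eventually_sequentially by blast
    then have "(\<lambda>n. P n w) \<longlonglongrightarrow> 0" by (rule tendsto_eventually)
    with lim[OF w(1)] have "f w = 0" by (rule LIMSEQ_unique)
    then show "Hinf_fun F w = 0" using F w(1) by simp
  qed
qed

section \<open>Cesaro means of the composition operator\<close>

lemma Hinf_fun_sum: "Hinf_fun (\<Sum>i\<in>I. f i) z = (\<Sum>i\<in>I. Hinf_fun (f i) z)"
  by (induction I rule: infinite_finite_induct) (simp_all add: zero_Hinf.rep_eq plus_Hinf.rep_eq)

lemma tendsto_Hinf_fun: "f \<longlonglongrightarrow> g \<Longrightarrow> (\<lambda>j. Hinf_fun (f j) z) \<longlonglongrightarrow> Hinf_fun g z"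
proof (rule Lim_transform_bound[THEN LIM_zero_cancel])
  show "\<forall>\<^sub>F j in sequentially. norm (Hinf_fun (f j) z - Hinf_fun g z) \<le> norm (norm (f j - g))"
    using Hinf_norm_le[of "f _ - g" z] by (simp add: minus_Hinf.rep_eq)
  show "f \<longlonglongrightarrow> g \<Longrightarrow> (\<lambda>j. norm (f j - g)) \<longlonglongrightarrow> 0"
    by (simp add: LIM_zero tendsto_norm_zero)
qed

context attracting_self_map
begin

lemma cesaro_mean_fun:
  "z \<in> ball 0 1 \<Longrightarrow>
    Hinf_fun (cesaro_mean j (comp_op \<phi>) f) z = (1 / real j) *\<^sub>R (\<Sum>i=1..j. Hinf_fun f ((\<phi> ^^ i) z))"
  by (simp add: cesaro_mean_def scaleR_Hinf.rep_eq Hinf_fun_sum comp_op_funpow)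

text \<open>The orbit tends to a and f is continuous at a. This identifies the only possible limit
  of the means.\<close>

lemma cesaro_mean_pointwise:
  assumes z: "z \<in> ball 0 1"
  shows "(\<lambda>j. Hinf_fun (cesaro_mean j (comp_op \<phi>) f) z) \<longlonglongrightarrow> Hinf_fun f a"
proof -
  have "isCont (Hinf_fun f) a"
    using Hinf_set_derivE[OF Hinf_fun a] has_derivative_continuous by metis
  from isCont_tendsto_compose[OF this pointwise_attraction[OF z]]
  have "(\<lambda>i. Hinf_fun f ((\<phi> ^^ i) z) - Hinf_fun f a) \<longlonglongrightarrow> 0" by (simp add: LIM_zero)
  note lim = cesaro_tendsto_zero[OF this]
  have "(\<lambda>j. Hinf_fun (cesaro_mean j (comp_op \<phi>) f) z - Hinf_fun f a) \<longlonglongrightarrow> 0"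
  proof (rule Lim_transform_eventually[OF lim])
    have "(1 / real j) *\<^sub>R (\<Sum>i=1..j. Hinf_fun f ((\<phi> ^^ i) z) - Hinf_fun f a)
        = Hinf_fun (cesaro_mean j (comp_op \<phi>) f) z - Hinf_fun f a" if "j \<ge> 1" for j
      using that
      by (simp add: cesaro_mean_fun[OF z] sum_subtractf scaleR_diff_right sum_constant_scaleR del: sum_constant)
    then show "\<forall>\<^sub>F j in sequentially. (1 / real j) *\<^sub>R (\<Sum>i=1..j. Hinf_fun f ((\<phi> ^^ i) z) - Hinf_fun f a)
        = Hinf_fun (cesaro_mean j (comp_op \<phi>) f) z - Hinf_fun f a"
      unfolding eventually_sequentially by blast
  qed
  then show ?thesis by (rule LIM_zero_cancel)
qed

text \<open>One function F handles all k at once: its k-th mean vanishes at \<open>z k\<close>,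
  whereas the limit of the means equals \<open>F a\<close> throughout the ball. The norm distance
  therefore never falls below the modulus of \<open>F a\<close>.\<close>

lemma mean_ergodic_imp_uniform_attraction:
  assumes "mean_ergodic (comp_op \<phi>)"
  shows uniform_attraction
proof (rule ccontr)
  assume neg: "\<not> uniform_attraction"
  define d where "d = 1 - norm a"
  have d: "0 < d" "d \<le> 1" using a by (auto simp: d_def)
  \<comment> \<open>Division by k + 1 pays for the k factors belonging to index k, the power of 1/2
    makes these costs summable, and \<open>d / 8\<close> keeps their total below d.\<close>
  define \<epsilon> where "\<epsilon> k = d / 8 * (1/2) ^ k / real (k + 1)" for k
  have \<epsilon>: "0 < \<epsilon> k" "\<epsilon> k < 1" "real k * \<epsilon> k \<le> d / 8 * (1/2) ^ k" for k
  proof -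
    show "0 < \<epsilon> k" using d by (simp add: \<epsilon>_def)
    have "\<epsilon> k \<le> d / 8 * (1/2) ^ k / 1" unfolding \<epsilon>_def using d by (intro divide_left_mono) auto
    also have "\<dots> \<le> d / 8 * 1" using d by (simp add: mult_left_le power_le_one)
    finally show "\<epsilon> k < 1" using d by simp
    have "real k * \<epsilon> k = d / 8 * (1/2) ^ k * (real k / real (k + 1))" by (simp add: \<epsilon>_def)
    also have "\<dots> \<le> d / 8 * (1/2) ^ k * 1" using d by (intro mult_left_mono) auto
    finally show "real k * \<epsilon> k \<le> d / 8 * (1/2) ^ k" by simp
  qed
  have "\<forall>k. \<exists>z\<in>ball 0 1. \<forall>i\<le>k. 1 - norm ((\<phi> ^^ i) z) < \<epsilon> k"
    using orbits_near_sphere[OF neg \<epsilon>(1)] by blast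
  then obtain z where z: "\<And>k. z k \<in> ball 0 1" "\<And>k i. i \<le> k \<Longrightarrow> 1 - norm ((\<phi> ^^ i) (z k)) < \<epsilon> k"
    by metis
  define p where "p k i = (\<phi> ^^ i) (z k)" for k i
  \<comment> \<open>The points are nonzero because \<open>\<epsilon> k\<close> is below 1; the
    Blaschke factor divides by their norm.\<close>
  have p: "norm (p k i) < 1" "i \<le> k \<Longrightarrow> p k i \<noteq> 0" "i \<le> k \<Longrightarrow> 1 - norm (p k i) \<le> \<epsilon> k" for k i
    using iterate_in_ball[OF z(1)] z(2)[of i k] \<epsilon>(2)[of k] by (auto simp: p_def)
  \<comment> \<open>The factors start at i = 1 because the Cesaro mean starts with the first
    power.\<close>
  define g where "g k w = (\<Prod>i=1..k. ball_blaschke (p k i) w)" for k w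
  \<comment> \<open>The factor 2 in the Blaschke estimate turns \<open>d / 8\<close> into
    \<open>d / 4\<close>; the series sums to \<open>d / 2\<close>.\<close>
  define c where "c k = d / 4 * (1/2) ^ k" for k :: nat
  have c_sums: "c sums (d / 4 * (1 / (1 - 1/2)))"
    unfolding c_def by (intro sums_mult geometric_sums) simp
  obtain F where F: "Hinf_fun F a \<noteq> 0" "\<And>k w. norm w < 1 \<Longrightarrow> g k w = 0 \<Longrightarrow> Hinf_fun F w = 0"
  proof (rule infinite_product_Hinf[of g c a])
    show "holomorphic_map_on (g k) (ball 0 1)" for k
      unfolding g_def[abs_def] using p by (intro holomorphic_map_on_prod holomorphic_ball_blaschke) auto
    fix k and w :: "complex ^ 'n" assume w: "norm w < 1"
    show "cmod (g k w) \<le> 1"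
      unfolding g_def prod_norm[symmetric] using p w
      by (intro prod_le_1 conjI norm_ball_blaschke_le) auto
    \<comment> \<open>For factors of modulus at most 1, the difference of two products is bounded by
      the sum of the differences of the factors.\<close>
    have "cmod (1 - g k w) = cmod ((\<Prod>i=1..k. 1) - (\<Prod>i=1..k. ball_blaschke (p k i) w))"
      by (simp add: g_def)
    also have "\<dots> \<le> (\<Sum>i=1..k. cmod (1 - ball_blaschke (p k i) w))"
      using p w by (intro norm_prod_diff norm_ball_blaschke_le) auto
    also have "\<dots> \<le> (\<Sum>i=1..k. 2 * \<epsilon> k / (1 - norm w))"
    proof (rule sum_mono)
      fix i assume i: "i \<in> {1..k}"
      have "cmod (1 - ball_blaschke (p k i) w) \<le> 2 * (1 - norm (p k i)) / (1 - norm w)"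
        using p i w by (intro ball_blaschke_near_one) auto
      also have "\<dots> \<le> 2 * \<epsilon> k / (1 - norm w)"
        using p(3)[of i k] i w by (intro divide_right_mono) auto
      finally show "cmod (1 - ball_blaschke (p k i) w) \<le> 2 * \<epsilon> k / (1 - norm w)" .
    qed
    also have "\<dots> = 2 * (real k * \<epsilon> k) / (1 - norm w)" by simp
    also have "\<dots> \<le> c k / (1 - norm w)"
      using \<epsilon>(3)[of k] w by (intro divide_right_mono) (auto simp: c_def)
    finally show "cmod (1 - g k w) \<le> c k / (1 - norm w)" .
  next
    show "summable c" using c_sums by (rule sums_summable)
    show "norm a < 1" using a by simp
    show "suminf c < 1 - norm a" using sums_unique[OF c_sums] d by (simp add: d_def)
  qed blast
  obtain P where P: "\<And>f. (\<lambda>j. cesaro_mean j (comp_op \<phi>) f) \<longlonglongrightarrow> P f"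
    using assms unfolding mean_ergodic_def by blast
  have PF: "Hinf_fun (P F) w = Hinf_fun F a" if "w \<in> ball 0 1" for w
    using LIMSEQ_unique[OF tendsto_Hinf_fun[OF P] cesaro_mean_pointwise[OF that]] .
  have zero: "Hinf_fun (cesaro_mean k (comp_op \<phi>) F) (z k) = 0" for k
  proof -
    have "Hinf_fun F (p k i) = 0" if "i \<in> {1..k}" for i
    proof (rule F(2)[of _ k])
      show "g k (p k i) = 0"
        unfolding g_def using that p by (intro prod_zero bexI[of _ i] ball_blaschke_self) auto
    qed (rule p)
    then show ?thesis by (simp add: cesaro_mean_fun[OF z(1)] p_def)
  qed
  have "cmod (Hinf_fun F a) \<le> norm (cesaro_mean k (comp_op \<phi>) F - P F)" for k
    using Hinf_norm_le[of "cesaro_mean k (comp_op \<phi>) F - P F" "z k"]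
    by (simp add: minus_Hinf.rep_eq zero PF[OF z(1)])
  moreover have "(\<lambda>k. norm (cesaro_mean k (comp_op \<phi>) F - P F)) \<longlonglongrightarrow> 0"
    using P by (simp add: LIM_zero tendsto_norm_zero)
  ultimately have "cmod (Hinf_fun F a) \<le> 0" by (intro LIMSEQ_le_const) auto
  with F(1) show False by simp
qed

end

theorem theorem3p12:
  fixes \<phi> :: "complex ^ 'n::finite \<Rightarrow> complex ^ 'n" and a :: "complex ^ 'n"
  assumes "holomorphic_map_on \<phi> (ball 0 1)"
    and "\<phi> ` ball 0 1 \<subseteq> ball 0 1"
    and "a \<in> ball 0 1" and "\<phi> a = a"
    and "matrix_spectrum (jacobian \<phi> (at a)) \<subseteq> ball 0 1"
  shows "(mean_ergodic (comp_op \<phi>) \<longleftrightarrow> uniformly_mean_ergodic (comp_op \<phi>)) \<and>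
    (uniformly_mean_ergodic (comp_op \<phi>) \<longleftrightarrow>
      (\<lambda>j. SUP z\<in>ball 0 1. norm ((\<phi> ^^ j) z - a)) \<longlonglongrightarrow> 0) \<and>
    ((\<lambda>j. SUP z\<in>ball 0 1. norm ((\<phi> ^^ j) z - a)) \<longlonglongrightarrow> 0 \<longleftrightarrow>
      quasi_compact (comp_op \<phi>))"
proof -
  interpret attracting_self_map \<phi> a
    using assms by unfold_locales
  note C = bounded_clinear_C
  note P = compact_operator_comp_op_const
  have "uniform_attraction \<Longrightarrow> uniformly_mean_ergodic (comp_op \<phi>)"
    using norm_convergence_imp_uniformly_mean_ergodic[OF C _ uniform_attraction_imp_norm_convergence]
      P unfolding compact_operator_def by blast
  moreover have "uniform_attraction \<Longrightarrow> quasi_compact (comp_op \<phi>)"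
    using norm_convergence_to_compact_imp_quasi_compact[OF C P uniform_attraction_imp_norm_convergence]
    by blast
  ultimately show ?thesis
    unfolding uniform_attraction_iff_SUP
    using uniformly_mean_ergodic_imp_mean_ergodic[OF C] mean_ergodic_imp_uniform_attraction
      quasi_compact_imp_uniform_attraction by blast
qed

end
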